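(* Let $\{\mathbb P_n\}_{n\ge0}$, $\mathbb P_n=(P_{n,0},P_{n,1},\dots,P_{n,n})^t$, be the orthogonal polynomial system with $$P_{n,m}(x,y)=p^{(m)}_{n-m}(x)\,\rho(x)^m\,q_m\!\left(\frac{y}{\rho(x)}\right),\qquad 0\le m\le n,$$ constructed from $u_x,v_y,\rho$ as in the context. Then the matrix coefficients of the second three term relation $$y\,\mathbb P_n=A_{n,2}\mathbb P_{n+1}+B_{n,2}\mathbb P_n+C_{n,2}\mathbb P_{n-1}\qquad(\mathbb P_{-1}=0)$$ are given by the tridiagonal matrices $$A_{n,2}=\left(\begin{array}{cccc|c} a^{(0)}_{2,n}&a^{(0)}_{3,n}&\ldots&0&0\\ a^{(1)}_{1,n-1}&a^{(1)}_{2,n-1}&\ddots&\vdots&\vdots\\ \vdots&\ddots&\ddots&a^{(n-1)}_{3,1}&0\\ 0&\ldots&a^{(n)}_{1,0}&a^{(n)}_{2,0}&a^{(n)}_{3,0} \end{array}\right),$$ of size $(n+1)\times(n+2)$, where $$a^{(m)}_{1,n-m}=\tilde c_m\,\eta^{(m-1)}_{n-m}\ (1\le m\le n),\qquad a^{(m)}_{3,n-m}=\tilde a_m\,\delta^{(m)}_{n-m}\ (0\le m\le n);$$ $$B_{n,2}=\left(\begin{array}{cccc} b^{(0)}_{2,n}&b^{(0)}_{3,n}&\ldots&0\\ b^{(1)}_{1,n-1}&b^{(1)}_{2,n-1}&\ddots&\vdots\\ \vdots&\ddots&\ddots&b^{(n-1)}_{3,1}\\ 0&\ldots&b^{(n)}_{1,0}&b^{(n)}_{2,0}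 \end{array}\right),$$ of size $(n+1)\times(n+1)$, where $$b^{(m)}_{1,n-m}=\tilde c_m\,\theta^{(m-1)}_{n-m}\ (1\le m\le n),\qquad b^{(m)}_{3,n-m}=\tilde a_m\,\epsilon^{(m)}_{n-m}\ (0\le m\le n-1);$$ $$C_{n,2}=\left(\begin{array}{cccc} c^{(0)}_{2,n}&c^{(0)}_{3,n}&\ldots&0\\ c^{(1)}_{1,n-1}&c^{(1)}_{2,n-1}&\ddots&\vdots\\ \vdots&\ddots&\ddots&c^{(n-2)}_{3,2}\\ 0&\ldots&c^{(n-1)}_{1,1}&c^{(n-1)}_{2,1}\\ \hline 0&\ldots&0&0 \end{array}\right),$$ of size $(n+1)\times n$ (the last row being identically zero), where $$c^{(m)}_{1,n-m}=\tilde c_m\,\vartheta^{(m-1)}_{n-m}\ (1\le m\le n-1),\qquad c^{(m)}_{3,n-m}=\tilde a_m\,\zeta^{(m)}_{n-m}\ (0\le m\le n-2);$$ and the diagonal entries are as follows. Case I: if $\rho(x)=r_1x+r_0$, where $|r_1|+|r_0|>0$, then $$a^{(m)}_{2,n-m}=\tilde b_m\,r_1\,a^{(m)}_{n-m}\quad(0\le m\le n),$$ $$b^{(m)}_{2,n-m}=\tilde b_m\,\rho(b^{(m)}_{n-m})=\tilde b_m\,(r_1b^{(m)}_{n-m}+r_0)\quad(0\le m\le n),$$ $$c^{(m)}_{2,n-m}=\tilde b_m\,r_1\,c^{(m)}_{n-m}\quad(0\le m\le n-1).$$ Case II: if $\rho(x)$ is the square root of a polynomial of degree at most $2$ (and $v_y$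 is symmetric), then $a^{(m)}_{2,n-m}=0$ and $b^{(m)}_{2,n-m}=0$ for $0\le m\le n$, and $c^{(m)}_{2,n-m}=0$ for $0\le m\le n-1$. All the scalars $a^{(m)}_n,b^{(m)}_n,c^{(m)}_n,\tilde a_n,\tilde b_n,\tilde c_n,\delta^{(m)}_n,\epsilon^{(m)}_n,\zeta^{(m)}_n,\eta^{(m)}_n,\theta^{(m)}_n,\vartheta^{(m)}_n$ are those defined in the context.
   Context: $\Pi$ is the space of real univariate polynomials. A (univariate) moment functional is a real linear functional on $\Pi$. An orthogonal polynomial sequence for a moment functional $u$ is a sequence $\{p_n\}_{n\ge0}\subset\Pi$ with $\deg p_n=n$ and $\langle u,p_np_m\rangle=h_n\delta_{n,m}$, $h_n\ne0$ for all $n$; $u$ is quasi-definite if such a sequence exists, and a quasi-definite $u$ is symmetric if $\langle u,x^{2n+1}\rangle=0$ for all $n\ge0$. Left multiplication is $\langle q\,u,p\rangle=\langle u,qp\rangle$. **Construction.** $u_x$, $v_y$ are quasi-definite moment functionals acting on the variables $x$, $y$, respectively, and $\rho(x)$ is a function satisfying one of: - Case I: $\rho(x)$ is a polynomial of degree at most $1$, $\rho(x)=r_1x+r_0$ with $|r_1|+|r_0|>0$. - Case II: $\rho(x)$ is the square root of a polynomial of degree at most $2$, and $v_y$ is symmetric. In both cases write $\rho(x)^2=s_2x^2+s_1x+s_0$, with $s_2,s_1,s_0\in\mathbb R$, $|s_2|+|s_1|+|s_0|>0$. It is assumed that $u^{(m)}_x=\rho(x)^{2m+1}u_x$ is a quasi-definite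 moment functional for every $m\ge0$. For each $m\ge0$, $\{p^{(m)}_n\}_{n\ge0}$ is an orthogonal polynomial sequence for $u^{(m)}_x$, and $\{q_n\}_{n\ge0}$ is an orthogonal polynomial sequence for $v_y$, with $p^{(m)}_{0}=1$, $q_0=1$. The $P_{n,m}$ are then bivariate polynomials of total degree $n$ (in Case II because $q_m$ has the parity of $m$), mutually orthogonal with respect to the bivariate moment functional $w$ given by $\langle w,x^hy^k\rangle=\langle\rho(x)^{k+1}u_x,x^h\rangle\langle v_y,y^k\rangle$, $h,k\ge0$. **Scalars.** Write $p^{(m)}_n(x)=k^{(m)}_nx^n+l^{(m)}_nx^{n-1}+\cdots$, $q_n(y)=\tilde k_ny^n+\tilde l_ny^{n-1}+\cdots$, $h^{(m)}_n=\langle u^{(m)}_x,(p^{(m)}_n)^2\rangle$, $\tilde h_n=\langle v_y,q_n^2\rangle$. The coefficients of the three term recurrence relations $x\,p^{(m)}_n=a^{(m)}_np^{(m)}_{n+1}+b^{(m)}_np^{(m)}_n+c^{(m)}_np^{(m)}_{n-1}$ and $y\,q_n=\tilde a_nq_{n+1}+\tilde b_nq_n+\tilde c_nq_{n-1}$ (with $p^{(m)}_{-1}=0$, $q_{-1}=0$) are $$a^{(m)}_n=\frac{k^{(m)}_n}{k^{(m)}_{n+1}},\quad b^{(m)}_n=\frac{l^{(m)}_n}{k^{(m)}_n}-\frac{l^{(m)}_{n+1}}{k^{(m)}_{n+1}},\quad c^{(m)}_n=a^{(m)}_{n-1}\frac{h^{(m)}_n}{h^{(m)}_{n-1}},$$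 $$\tilde a_n=\frac{\tilde k_n}{\tilde k_{n+1}},\quad \tilde b_n=\frac{\tilde l_n}{\tilde k_n}-\frac{\tilde l_{n+1}}{\tilde k_{n+1}},\quad \tilde c_n=\tilde a_{n-1}\frac{\tilde h_n}{\tilde h_{n-1}}.$$ Moreover, for $m\ge0$, $$\delta^{(m)}_n=\frac{k^{(m)}_n}{k^{(m+1)}_n},\quad \epsilon^{(m)}_n=\frac{l^{(m)}_n}{k^{(m+1)}_{n-1}}-\frac{k^{(m)}_n}{k^{(m+1)}_n}\frac{l^{(m+1)}_n}{k^{(m+1)}_{n-1}},\quad \zeta^{(m)}_n=s_2\frac{k^{(m+1)}_{n-2}}{k^{(m)}_n}\frac{h^{(m)}_n}{h^{(m+1)}_{n-2}},$$ $$\eta^{(m)}_n=s_2\frac{k^{(m+1)}_n}{k^{(m)}_{n+2}},\quad \theta^{(m)}_n=\epsilon^{(m)}_{n+1}\frac{h^{(m+1)}_n}{h^{(m)}_{n+1}},\quad \vartheta^{(m)}_n=\delta^{(m)}_n\frac{h^{(m+1)}_n}{h^{(m)}_n};$$ these are the coefficients in $p^{(m)}_n=\delta^{(m)}_np^{(m+1)}_n+\epsilon^{(m)}_np^{(m+1)}_{n-1}+\zeta^{(m)}_np^{(m+1)}_{n-2}$ and $\rho^2p^{(m+1)}_n=\eta^{(m)}_np^{(m)}_{n+2}+\theta^{(m)}_np^{(m)}_{n+1}+\vartheta^{(m)}_np^{(m)}_n$.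
   Formalization: The last row of C_{n,2} is not zero for n≥1: it is (0,…,0, c̃_n ϑ^{(n-1)}_0), so c_1^{(m)} runs over 1≤m≤n; e.g. for ρ=1, v_y symmetric, q_n monic, yP_{1,1}=P_{2,2}+c̃_1P_{0,0} with c̃_1≠0. *)

theory Defs
  imports Complex_Main "HOL-Computational_Algebra.Polynomial" "Jordan_Normal_Form.Matrix"
begin

section \<open>Univariate moment functionals and orthogonal polynomial sequences\<close>

definition moment_functional :: "(real poly \<Rightarrow> real) \<Rightarrow> bool" where
  "moment_functional u \<longleftrightarrow> Vector_Spaces.linear Polynomial.smult ((*) :: real \<Rightarrow> real \<Rightarrow> real) u"

definition ops :: "(real poly \<Rightarrow> real) \<Rightarrow> (nat \<Rightarrow> real poly) \<Rightarrow> bool" where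
  "ops u p \<longleftrightarrow> (\<forall>n. degree (p n) = n) \<and>
     (\<exists>h. (\<forall>n. h n \<noteq> 0) \<and> (\<forall>n m. u (p n * p m) = (if n = m then h n else 0)))"

definition quasi_definite :: "(real poly \<Rightarrow> real) \<Rightarrow> bool" where
  "quasi_definite u \<longleftrightarrow> moment_functional u \<and> (\<exists>p. ops u p)"

definition symmetric_functional :: "(real poly \<Rightarrow> real) \<Rightarrow> bool" where
  "symmetric_functional u \<longleftrightarrow> quasi_definite u \<and> (\<forall>n. u (monom 1 (2 * n + 1)) = 0)"


section \<open>The function \<open>\<rho>\<close> and the functionals \<open>\<rho>\<^sup>k u\<^sub>x\<close>\<close>

text \<open>
  \<open>\<rho>\<close> is complex-valued because the polynomial of which it is a square root may be negative
  on part of the real line (as for \<open>1 - x\<^sup>2\<close>); no branch of the square root is prescribed.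

  If \<open>\<rho>\<close> is not a polynomial, \<open>\<rho> u\<^sub>x\<close> only makes sense if \<open>u\<^sub>x\<close> also acts on \<open>\<rho>\<close> times
  polynomials. Hence \<open>u\<^sub>x\<close> is given as a real linear functional \<open>U\<close> on the real vector space of
  functions \<open>f + \<rho> g\<close> with real polynomials \<open>f\<close>, \<open>g\<close>; values of \<open>U\<close> elsewhere are irrelevant.
  This space is closed under multiplication by \<open>\<rho>\<close> whenever \<open>\<rho>\<^sup>2\<close> is a real polynomial, and it is
  just the space of polynomials if \<open>\<rho>\<close> is itself a real polynomial.
\<close>

definition rho_space :: "(real \<Rightarrow> complex) \<Rightarrow> (real \<Rightarrow> complex) set" where
  "rho_space \<rho> = {\<lambda>x. of_real (poly f x) + \<rho> x * of_real (poly g x) | f g. True}"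

definition linear_on_rho_space :: "(real \<Rightarrow> complex) \<Rightarrow> ((real \<Rightarrow> complex) \<Rightarrow> real) \<Rightarrow> bool" where
  "linear_on_rho_space \<rho> U \<longleftrightarrow>
     (\<forall>F\<in>rho_space \<rho>. \<forall>G\<in>rho_space \<rho>. U (\<lambda>x. F x + G x) = U F + U G) \<and>
     (\<forall>c::real. \<forall>F\<in>rho_space \<rho>. U (\<lambda>x. of_real c * F x) = c * U F)"

text \<open>The functional \<open>\<rho>\<^sup>k u\<^sub>x\<close> on polynomials; \<open>k = 0\<close> gives \<open>u\<^sub>x\<close> itself.\<close>

definition rho_pow_functional ::
    "(real \<Rightarrow> complex) \<Rightarrow> ((real \<Rightarrow> complex) \<Rightarrow> real) \<Rightarrow> nat \<Rightarrow> real poly \<Rightarrow> real" where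
  "rho_pow_functional \<rho> U k f = U (\<lambda>x. \<rho> x ^ k * of_real (poly f x))"

definition u_m :: "(real \<Rightarrow> complex) \<Rightarrow> ((real \<Rightarrow> complex) \<Rightarrow> real) \<Rightarrow> nat \<Rightarrow> real poly \<Rightarrow> real" where
  "u_m \<rho> U m = rho_pow_functional \<rho> U (2 * m + 1)"

definition case_I :: "(real \<Rightarrow> complex) \<Rightarrow> real \<Rightarrow> real \<Rightarrow> bool" where
  "case_I \<rho> r1 r0 \<longleftrightarrow> (\<forall>x. \<rho> x = of_real (r1 * x + r0)) \<and> \<bar>r1\<bar> + \<bar>r0\<bar> > 0"

definition case_II :: "(real \<Rightarrow> complex) \<Rightarrow> (real poly \<Rightarrow> real) \<Rightarrow> bool" where
  "case_II \<rho> v \<longleftrightarrow>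
     (\<exists>s. degree s \<le> 2 \<and> (\<forall>x. (\<rho> x)\<^sup>2 = of_real (poly s x))) \<and> symmetric_functional v"


section \<open>The bivariate polynomials\<close>

text \<open>
  A bivariate polynomial in \<open>x\<close>, \<open>y\<close> is a \<open>real poly poly\<close>, viewed as a polynomial in \<open>y\<close> whose
  coefficients are polynomials in \<open>x\<close>; its value at \<open>(x, y)\<close> is \<open>poly (poly P [:y:]) x\<close>.
  \<open>P_poly \<rho> p q n m\<close> is the bivariate polynomial that takes the values
  \<open>p\<^sup>(\<^sup>m\<^sup>)\<^sub>n\<^sub>-\<^sub>m(x) \<rho>(x)\<^sup>m q\<^sub>m(y / \<rho>(x))\<close> wherever \<open>\<rho>(x) \<noteq> 0\<close>; it is unique
  because \<open>\<rho>\<close> has at most finitely many zeros. Here \<open>p m\<close> is the sequence \<open>p\<^sup>(\<^sup>m\<^sup>)\<close>.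
\<close>

definition P_poly ::
    "(real \<Rightarrow> complex) \<Rightarrow> (nat \<Rightarrow> nat \<Rightarrow> real poly) \<Rightarrow> (nat \<Rightarrow> real poly) \<Rightarrow> nat \<Rightarrow> nat \<Rightarrow> real poly poly"
  where
  "P_poly \<rho> p q n m = (THE P. \<forall>x y. \<rho> x \<noteq> 0 \<longrightarrow>
     of_real (poly (poly P [:y:]) x) =
       of_real (poly (p m (n - m)) x) * \<rho> x ^ m * poly (map_poly of_real (q m)) (of_real y / \<rho> x))"

definition PP :: "(real \<Rightarrow> complex) \<Rightarrow> (nat \<Rightarrow> nat \<Rightarrow> real poly) \<Rightarrow> (nat \<Rightarrow> real poly) \<Rightarrow>
    nat \<Rightarrow> real poly poly vec" where
  "PP \<rho> p q n = vec (n + 1) (\<lambda>m. P_poly \<rho> p q n m)"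

text \<open>\<open>\<bbbP>\<^sub>n\<^sub>-\<^sub>1\<close>, where \<open>\<bbbP>\<^sub>-\<^sub>1 = 0\<close> is the vector of dimension \<open>0\<close>.\<close>

definition PP_prev :: "(real \<Rightarrow> complex) \<Rightarrow> (nat \<Rightarrow> nat \<Rightarrow> real poly) \<Rightarrow> (nat \<Rightarrow> real poly) \<Rightarrow>
    nat \<Rightarrow> real poly poly vec" where
  "PP_prev \<rho> p q n = (if n = 0 then 0\<^sub>v 0 else PP \<rho> p q (n - 1))"

definition const_mat :: "real mat \<Rightarrow> real poly poly mat" where
  "const_mat M = map_mat (\<lambda>c. [:[:c:]:]) M"

text \<open>The relation \<open>y \<bbbP>\<^sub>n = A \<bbbP>\<^sub>n\<^sub>+\<^sub>1 + B \<bbbP>\<^sub>n + C \<bbbP>\<^sub>n\<^sub>-\<^sub>1\<close>; the polynomial \<open>[:0, 1:]\<close> is \<open>y\<close>.\<close>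

definition second_three_term_relation ::
    "(real \<Rightarrow> complex) \<Rightarrow> (nat \<Rightarrow> nat \<Rightarrow> real poly) \<Rightarrow> (nat \<Rightarrow> real poly) \<Rightarrow> nat \<Rightarrow>
     real mat \<Rightarrow> real mat \<Rightarrow> real mat \<Rightarrow> bool" where
  "second_three_term_relation \<rho> p q n A B C \<longleftrightarrow>
     [:0, 1:] \<cdot>\<^sub>v PP \<rho> p q n =
       const_mat A *\<^sub>v PP \<rho> p q (n + 1) + const_mat B *\<^sub>v PP \<rho> p q n + const_mat C *\<^sub>v PP_prev \<rho> p q n"


section \<open>Scalars\<close>

text \<open>Leading coefficient, second coefficient (zero for \<open>n = 0\<close>) and squared norm of the
  \<open>n\<close>-th member of a sequence.\<close>

definition k_c :: "(nat \<Rightarrow> real poly) \<Rightarrow> nat \<Rightarrow> real" where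
  "k_c p n = coeff (p n) n"

definition l_c :: "(nat \<Rightarrow> real poly) \<Rightarrow> nat \<Rightarrow> real" where
  "l_c p n = (if n = 0 then 0 else coeff (p n) (n - 1))"

definition h_c :: "(real poly \<Rightarrow> real) \<Rightarrow> (nat \<Rightarrow> real poly) \<Rightarrow> nat \<Rightarrow> real" where
  "h_c u p n = u ((p n)\<^sup>2)"

text \<open>Coefficients of the three term recurrence; \<open>ttr_c\<close> is meaningful for \<open>n \<ge> 1\<close> only.\<close>

definition ttr_a :: "(nat \<Rightarrow> real poly) \<Rightarrow> nat \<Rightarrow> real" where
  "ttr_a p n = k_c p n / k_c p (n + 1)"

definition ttr_b :: "(nat \<Rightarrow> real poly) \<Rightarrow> nat \<Rightarrow> real" where
  "ttr_b p n = l_c p n / k_c p n - l_c p (n + 1) / k_c p (n + 1)"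

definition ttr_c :: "(real poly \<Rightarrow> real) \<Rightarrow> (nat \<Rightarrow> real poly) \<Rightarrow> nat \<Rightarrow> real" where
  "ttr_c u p n = ttr_a p (n - 1) * (h_c u p n / h_c u p (n - 1))"

text \<open>Connection coefficients between \<open>p\<^sup>(\<^sup>m\<^sup>)\<close> and \<open>p\<^sup>(\<^sup>m\<^sup>+\<^sup>1\<^sup>)\<close>. Here \<open>u m\<close> is the functional of
  \<open>p m\<close>; \<open>eps_c\<close> and \<open>zeta_c\<close> are meaningful for \<open>n \<ge> 1\<close> and \<open>n \<ge> 2\<close> only.\<close>

definition delta_c :: "(nat \<Rightarrow> nat \<Rightarrow> real poly) \<Rightarrow> nat \<Rightarrow> nat \<Rightarrow> real" where
  "delta_c p m n = k_c (p m) n / k_c (p (m + 1)) n"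

definition eps_c :: "(nat \<Rightarrow> nat \<Rightarrow> real poly) \<Rightarrow> nat \<Rightarrow> nat \<Rightarrow> real" where
  "eps_c p m n = l_c (p m) n / k_c (p (m + 1)) (n - 1)
     - k_c (p m) n / k_c (p (m + 1)) n * (l_c (p (m + 1)) n / k_c (p (m + 1)) (n - 1))"

definition zeta_c :: "real \<Rightarrow> (nat \<Rightarrow> real poly \<Rightarrow> real) \<Rightarrow> (nat \<Rightarrow> nat \<Rightarrow> real poly) \<Rightarrow>
    nat \<Rightarrow> nat \<Rightarrow> real" where
  "zeta_c s2 u p m n = s2 * (k_c (p (m + 1)) (n - 2) / k_c (p m) n)
     * (h_c (u m) (p m) n / h_c (u (m + 1)) (p (m + 1)) (n - 2))"

definition eta_c :: "real \<Rightarrow> (nat \<Rightarrow> nat \<Rightarrow> real poly) \<Rightarrow> nat \<Rightarrow> nat \<Rightarrow> real" where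
  "eta_c s2 p m n = s2 * (k_c (p (m + 1)) n / k_c (p m) (n + 2))"

definition theta_c :: "(nat \<Rightarrow> real poly \<Rightarrow> real) \<Rightarrow> (nat \<Rightarrow> nat \<Rightarrow> real poly) \<Rightarrow>
    nat \<Rightarrow> nat \<Rightarrow> real" where
  "theta_c u p m n = eps_c p m (n + 1) * (h_c (u (m + 1)) (p (m + 1)) n / h_c (u m) (p m) (n + 1))"

definition vartheta_c :: "(nat \<Rightarrow> real poly \<Rightarrow> real) \<Rightarrow> (nat \<Rightarrow> nat \<Rightarrow> real poly) \<Rightarrow>
    nat \<Rightarrow> nat \<Rightarrow> real" where
  "vartheta_c u p m n = delta_c p m n * (h_c (u (m + 1)) (p (m + 1)) n / h_c (u m) (p m) n)"


section \<open>The coefficient matrices\<close>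

text \<open>Rows and columns are indexed from \<open>0\<close>; \<open>e1 m\<close>, \<open>e2 m\<close>, \<open>e3 m\<close> are the subdiagonal, diagonal
  and superdiagonal entries in row \<open>m\<close>, present when the corresponding column exists.\<close>

definition tridiag_mat :: "nat \<Rightarrow> nat \<Rightarrow> (nat \<Rightarrow> real) \<Rightarrow> (nat \<Rightarrow> real) \<Rightarrow> (nat \<Rightarrow> real) \<Rightarrow> real mat" where
  "tridiag_mat nr nc e1 e2 e3 = mat nr nc (\<lambda>(i, j).
     if i = j + 1 then e1 i else if i = j then e2 i else if j = i + 1 then e3 i else 0)"

text \<open>The diagonal entries \<open>d\<close> depend on the case and are therefore left as a parameter.\<close>

definition A2_mat :: "real \<Rightarrow> (nat \<Rightarrow> nat \<Rightarrow> real poly) \<Rightarrow> (real poly \<Rightarrow> real) \<Rightarrow> (nat \<Rightarrow> real poly) \<Rightarrow>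
    nat \<Rightarrow> (nat \<Rightarrow> real) \<Rightarrow> real mat" where
  "A2_mat s2 p v q n d = tridiag_mat (n + 1) (n + 2)
     (\<lambda>m. ttr_c v q m * eta_c s2 p (m - 1) (n - m)) d
     (\<lambda>m. ttr_a q m * delta_c p m (n - m))"

definition B2_mat :: "(nat \<Rightarrow> real poly \<Rightarrow> real) \<Rightarrow> (nat \<Rightarrow> nat \<Rightarrow> real poly) \<Rightarrow>
    (real poly \<Rightarrow> real) \<Rightarrow> (nat \<Rightarrow> real poly) \<Rightarrow> nat \<Rightarrow> (nat \<Rightarrow> real) \<Rightarrow> real mat" where
  "B2_mat u p v q n d = tridiag_mat (n + 1) (n + 1)
     (\<lambda>m. ttr_c v q m * theta_c u p (m - 1) (n - m)) d
     (\<lambda>m. ttr_a q m * eps_c p m (n - m))"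

text \<open>
  The last row \<open>m = n\<close> of this matrix is not zero for \<open>n \<ge> 1\<close>: it is
  \<open>(0, \<dots>, 0, ttr_c v q n * vartheta_c u p (n - 1) 0)\<close>, since \<open>\<rho>\<^sup>2 p\<^sup>(\<^sup>n\<^sup>)\<^sub>0\<close> has the component
  \<open>vartheta_c u p (n - 1) 0\<close> along \<open>p\<^sup>(\<^sup>n\<^sup>-\<^sup>1\<^sup>)\<^sub>0\<close>. (For \<open>\<rho> = 1\<close> and monic \<open>q\<^sub>n\<close>, this is the last term in
  \<open>y q\<^sub>n = q\<^sub>n\<^sub>+\<^sub>1 + b q\<^sub>n + c q\<^sub>n\<^sub>-\<^sub>1\<close>.) A version of this matrix with vanishing last row cannot satisfy the
  three term relation.
\<close>

definition C2_mat :: "real \<Rightarrow> (nat \<Rightarrow> real poly \<Rightarrow> real) \<Rightarrow> (nat \<Rightarrow> nat \<Rightarrow> real poly) \<Rightarrow>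
    (real poly \<Rightarrow> real) \<Rightarrow> (nat \<Rightarrow> real poly) \<Rightarrow> nat \<Rightarrow> (nat \<Rightarrow> real) \<Rightarrow> real mat" where
  "C2_mat s2 u p v q n d = tridiag_mat (n + 1) n
     (\<lambda>m. ttr_c v q m * vartheta_c u p (m - 1) (n - m)) d
     (\<lambda>m. ttr_a q m * zeta_c s2 u p m (n - m))"

end

theory Submission
  imports Defs
begin

text \<open>Where \<open>\<rho> \<noteq> 0\<close>, that is at all but finitely many \<open>x\<close>, put \<open>z = y / \<rho>\<close>. Then \<open>y P\<^sub>n\<^sub>,\<^sub>m\<close> is
  \<open>p\<^sup>(\<^sup>m\<^sup>)\<^sub>n\<^sub>-\<^sub>m(x) \<rho>\<^sup>m\<^sup>+\<^sup>1\<close> times \<open>z q\<^sub>m(z)\<close>, and the recurrence for \<open>q\<close> splits it into three parts. In the part with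
  \<open>q\<^sub>m\<^sub>+\<^sub>1\<close> one expands \<open>p\<^sup>(\<^sup>m\<^sup>)\<close> in the \<open>p\<^sup>(\<^sup>m\<^sup>+\<^sup>1\<^sup>)\<close>; in the part with \<open>q\<^sub>m\<^sub>-\<^sub>1\<close> one expands \<open>\<rho>\<^sup>2 p\<^sup>(\<^sup>m\<^sup>)\<close> in the
  \<open>p\<^sup>(\<^sup>m\<^sup>-\<^sup>1\<^sup>)\<close>; in the part with \<open>q\<^sub>m\<close> one uses the recurrence of \<open>p\<^sup>(\<^sup>m\<^sup>)\<close>, unless \<open>v\<close> is symmetric and the part
  vanishes. The expansions are short because \<open>u\<^sup>(\<^sup>m\<^sup>+\<^sup>1\<^sup>) = \<rho>\<^sup>2 u\<^sup>(\<^sup>m\<^sup>)\<close> with \<open>deg \<rho>\<^sup>2 \<le> 2\<close>. The matrices are unique because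
  the \<open>P\<^sub>n\<^sub>,\<^sub>m\<close> are triangular in the degree in \<open>y\<close>.\<close>

section \<open>Moment functionals and orthogonal expansions in one variable\<close>

lemma moment_functional_add: "moment_functional u \<Longrightarrow> u (f + g) = u f + u g"
  by (simp add: moment_functional_def Vector_Spaces.linear_def module_hom_def module_hom_axioms_def)

lemma moment_functional_smult: "moment_functional u \<Longrightarrow> u (Polynomial.smult c f) = c * u f"
  by (simp add: moment_functional_def Vector_Spaces.linear_def module_hom_def module_hom_axioms_def)

lemma moment_functional_0: "moment_functional u \<Longrightarrow> u 0 = 0"
  using moment_functional_smult[of u 0 0] by simp

lemma moment_functional_sum:
  "moment_functional u \<Longrightarrow> u (\<Sum>i\<in>A. f i) = (\<Sum>i\<in>A. u (f i))"
  by (induction A rule: infinite_finite_induct)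
    (simp_all add: moment_functional_0 moment_functional_add)

locale orthogonal_sequence =
  fixes u :: "real poly \<Rightarrow> real" and p :: "nat \<Rightarrow> real poly"
  assumes functional: "moment_functional u" and ops: "ops u p"
begin

lemmas functional_add = moment_functional_add[OF functional]
  and functional_smult = moment_functional_smult[OF functional]
  and functional_0 = moment_functional_0[OF functional]
  and functional_sum = moment_functional_sum[OF functional]

lemma functional_diff: "u (f - g) = u f - u g"
  using functional_add[of "f - g" g] by simp

lemma degree_p: "degree (p n) = n"
  using ops by (simp add: ops_def)

lemma orthogonal: "n \<noteq> m \<Longrightarrow> u (p n * p m) = 0"
  using ops by (auto simp: ops_def)

lemma norm_nonzero: "h_c u p n \<noteq> 0"
proof -
  from ops obtain h where "\<And>n. h n \<noteq> 0" "\<And>n m. u (p n * p m) = (if n = m then h n else 0)"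
    unfolding ops_def by blast
  then show ?thesis by (simp add: h_c_def power2_eq_square)
qed

lemma norm_eq: "u (p n * p n) = h_c u p n"
  by (simp add: h_c_def power2_eq_square)

lemma lead_nonzero: "k_c p n \<noteq> 0"
proof (cases n)
  case 0
  \<comment> \<open>Degree 0 does not exclude the zero polynomial; the nonvanishing norm
    does.\<close>
  have "p 0 \<noteq> 0"
    using norm_nonzero[of 0] by (auto simp: h_c_def functional_0)
  then show ?thesis
    using 0 degree_p[of 0] leading_coeff_neq_0[of "p 0"] by (simp add: k_c_def)
next
  case (Suc k)
  then have "p n \<noteq> 0" using degree_p[of n] by auto
  then show ?thesis
    using degree_p[of n] leading_coeff_neq_0[of "p n"] by (simp add: k_c_def)
qed

lemma coeff_above: "n < i \<Longrightarrow> coeff (p n) i = 0"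
  by (simp add: coeff_eq_0 degree_p)

lemma in_span: "degree f \<le> n \<Longrightarrow> \<exists>c. f = (\<Sum>j\<le>n. Polynomial.smult (c j) (p j))"
proof (induction n arbitrary: f)
  case 0
  then obtain a where a: "f = [:a:]" using degree_eq_zeroE[of f] by auto
  obtain b where b: "p 0 = [:b:]" using degree_p[of 0] degree_eq_zeroE[of "p 0"] by auto
  have "b \<noteq> 0" using lead_nonzero[of 0] b by (simp add: k_c_def)
  then show ?case using a b by (intro exI[of _ "\<lambda>_. a / b"]) simp
next
  case (Suc n)
  define t where "t = coeff f (Suc n) / k_c p (Suc n)"
  let ?g = "f - Polynomial.smult t (p (Suc n))"
  have "degree ?g \<le> n"
  proof (rule degree_le, intro allI impI)
    fix i assume "n < i"
    then consider "i = Suc n" | "i > Suc n" by linarith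
    then show "coeff ?g i = 0"
    proof cases
      case 1
      then show ?thesis using lead_nonzero[of "Suc n"] by (simp add: t_def k_c_def)
    next
      case 2
      then show ?thesis using Suc.prems by (simp add: coeff_above coeff_eq_0)
    qed
  qed
  then obtain c where c: "?g = (\<Sum>j\<le>n. Polynomial.smult (c j) (p j))" using Suc.IH by blast
  have "f = ?g + Polynomial.smult t (p (Suc n))" by simp
  also have "\<dots> = (\<Sum>j\<le>Suc n. Polynomial.smult ((c(Suc n := t)) j) (p j))"
    unfolding c by simp
  finally show ?case by blast
qed

lemma expansion:
  assumes "degree f \<le> n"
  shows "f = (\<Sum>j\<le>n. Polynomial.smult (u (f * p j) / h_c u p j) (p j))"
proof -
  obtain c where c: "f = (\<Sum>j\<le>n. Polynomial.smult (c j) (p j))" using in_span[OF assms] by blast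
  have "u (f * p i) / h_c u p i = c i" if "i \<le> n" for i
  proof -
    have "u (f * p i) = (\<Sum>j\<le>n. c j * u (p j * p i))"
      by (subst c) (simp add: sum_distrib_right functional_sum functional_smult)
    also have "\<dots> = (\<Sum>j\<le>n. if j = i then c i * h_c u p i else 0)"
      by (intro sum.cong) (auto simp: orthogonal norm_eq)
    also have "\<dots> = c i * h_c u p i" using that by simp
    finally show ?thesis using norm_nonzero by simp
  qed
  then show ?thesis by (subst c) (intro sum.cong, auto)
qed

text \<open>When \<open>g\<close> is expanded in the \<open>p j\<close>, only the component along
  \<open>p n\<close> reaches the coefficient of degree \<open>n\<close>, and pairing with
  \<open>p n\<close> extracts exactly this component.\<close>

lemma functional_lead:
  assumes "degree g \<le> n"
  shows "u (p n * g) = coeff g n / k_c p n * h_c u p n"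
proof -
  have "coeff g n = (\<Sum>j\<le>n. u (g * p j) / h_c u p j * coeff (p j) n)"
    by (subst expansion[OF assms]) (simp add: coeff_sum)
  also have "\<dots> = (\<Sum>j\<le>n. if j = n then u (g * p n) / h_c u p n * k_c p n else 0)"
    by (intro sum.cong) (auto simp: k_c_def coeff_above)
  finally show ?thesis
    using lead_nonzero[of n] norm_nonzero[of n] by (simp add: field_simps)
qed

lemma functional_lower: "degree g < n \<Longrightarrow> u (p n * g) = 0"
  using functional_lead[of g n] by (simp add: coeff_eq_0)

text \<open>Orthogonality to the first \<open>n\<close> members leaves the three top terms of the
  expansion. The middle coefficient is offered in two forms: comparing coefficients of
  \<open>f\<close> yields \<open>ttr_b\<close> and \<open>eps_c\<close>, while the quotient of
  functional and norm yields \<open>theta_c\<close>.\<close>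

lemma band_expansion:
  assumes "degree f \<le> n + 2" and "\<And>j. j < n \<Longrightarrow> u (f * p j) = 0"
  obtains a b where
    "f = Polynomial.smult a (p (n + 2)) + Polynomial.smult b (p (n + 1))
         + Polynomial.smult (u (f * p n) / h_c u p n) (p n)"
    "b = u (f * p (n + 1)) / h_c u p (n + 1)"
    "coeff f (n + 2) = a * k_c p (n + 2)"
    "coeff f (n + 1) = a * l_c p (n + 2) + b * k_c p (n + 1)"
proof -
  define c where "c j = u (f * p j) / h_c u p j" for j
  have "f = (\<Sum>j\<le>Suc (Suc n). Polynomial.smult (c j) (p j))"
    using expansion[of f "Suc (Suc n)"] assms(1) by (simp add: c_def)
  also have "\<dots> = (\<Sum>j<n. Polynomial.smult (c j) (p j)) + Polynomial.smult (c n) (p n)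
      + Polynomial.smult (c (n + 1)) (p (n + 1)) + Polynomial.smult (c (n + 2)) (p (n + 2))"
    by (simp add: lessThan_Suc_atMost[symmetric] del: sum.lessThan_Suc)
      (simp add: sum.lessThan_Suc)
  also have "(\<Sum>j<n. Polynomial.smult (c j) (p j)) = 0"
    by (intro sum.neutral) (auto simp: c_def assms(2))
  finally have *: "f = Polynomial.smult (c (n + 2)) (p (n + 2))
      + Polynomial.smult (c (n + 1)) (p (n + 1)) + Polynomial.smult (c n) (p n)"
    by (simp add: algebra_simps)
  show ?thesis
  proof (rule that[of "c (n + 2)" "c (n + 1)"])
    show "coeff f (n + 2) = c (n + 2) * k_c p (n + 2)"
      by (subst *) (simp add: k_c_def coeff_above)
    show "coeff f (n + 1) = c (n + 2) * l_c p (n + 2) + c (n + 1) * k_c p (n + 1)"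
      by (subst *) (simp add: k_c_def l_c_def coeff_above)
  qed (use * in \<open>simp_all add: c_def\<close>)
qed

text \<open>Takes the place of \<open>band_expansion\<close> at the start of a sequence, where the
  third term is missing.\<close>

lemma expansion_linear:
  assumes "degree f \<le> 1"
  obtains a b where
    "f = Polynomial.smult a (p 1) + Polynomial.smult b (p 0)"
    "coeff f 1 = a * k_c p 1" "coeff f 0 = a * l_c p 1 + b * k_c p 0"
proof -
  define c where "c j = u (f * p j) / h_c u p j" for j
  have *: "f = Polynomial.smult (c 1) (p 1) + Polynomial.smult (c 0) (p 0)"
    using expansion[of f 1] assms by (simp add: c_def add.commute)
  show ?thesis
  proof (rule that[of "c 1" "c 0"])
    show "coeff f 1 = c 1 * k_c p 1" by (subst *) (simp add: k_c_def coeff_above)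
    show "coeff f 0 = c 1 * l_c p 1 + c 0 * k_c p 0"
      by (subst *) (simp add: k_c_def l_c_def)
  qed (rule *)
qed

text \<open>Multiplication by x, that is \<open>pCons 0\<close>, can be moved to the other factor
  inside \<open>u\<close>, and x times \<open>p j\<close> has degree below \<open>n\<close> as long
  as \<open>j + 1 < n\<close>.\<close>

lemma three_term_recurrence:
  "pCons 0 (p n) = Polynomial.smult (ttr_a p n) (p (n + 1)) + Polynomial.smult (ttr_b p n) (p n)
     + (if n = 0 then 0 else Polynomial.smult (ttr_c u p n) (p (n - 1)))"
proof (cases n)
  case 0
  have "degree (pCons 0 (p 0)) \<le> 1"
    using degree_pCons_le[of 0 "p 0"] by (simp add: degree_p)
  then obtain a b where ab: "pCons 0 (p 0) = Polynomial.smult a (p 1) + Polynomial.smult b (p 0)"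
    "coeff (pCons 0 (p 0)) 1 = a * k_c p 1"
    "coeff (pCons 0 (p 0)) 0 = a * l_c p 1 + b * k_c p 0"
    by (rule expansion_linear)
  have "a = ttr_a p 0"
    using ab(2) lead_nonzero[of 1] by (simp add: ttr_a_def k_c_def field_simps)
  moreover have "b = ttr_b p 0"
  proof -
    have "b = - (a * l_c p 1) / k_c p 0"
      using ab(3) lead_nonzero[of 0] by (simp add: field_simps)
    then show ?thesis
      using lead_nonzero[of 0] \<open>a = ttr_a p 0\<close> by (simp add: ttr_b_def ttr_a_def l_c_def)
  qed
  ultimately show ?thesis using ab(1) 0 by simp
next
  case (Suc k)
  let ?f = "pCons 0 (p n)"
  have deg: "degree ?f \<le> k + 2"
    using degree_pCons_le[of 0 "p n"] Suc by (simp add: degree_p)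
  have f: "?f * g = p n * pCons 0 g" for g by simp
  have "u (?f * p j) = 0" if "j < k" for j
    unfolding f using that Suc degree_pCons_le[of 0 "p j"]
    by (intro functional_lower) (simp add: degree_p)
  then obtain a b where ab: "?f = Polynomial.smult a (p (k + 2)) + Polynomial.smult b (p (k + 1))
         + Polynomial.smult (u (?f * p k) / h_c u p k) (p k)"
    "b = u (?f * p (k + 1)) / h_c u p (k + 1)"
    "coeff ?f (k + 2) = a * k_c p (k + 2)"
    "coeff ?f (k + 1) = a * l_c p (k + 2) + b * k_c p (k + 1)"
    using band_expansion[OF deg] by blast
  have a: "a = ttr_a p n"
    using ab(3) Suc lead_nonzero[of "k + 2"] by (simp add: ttr_a_def k_c_def field_simps)
  have b: "b = ttr_b p n"
    using ab(4) Suc lead_nonzero[of "k + 1"] lead_nonzero[of "k + 2"] a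
    by (simp add: ttr_b_def ttr_a_def l_c_def field_simps)
  \<comment> \<open>Here \<open>n = k + 1\<close>, so x times \<open>p k\<close> has degree at most
    \<open>n\<close>, and its coefficient of degree \<open>n\<close> is the leading coefficient of
    \<open>p k\<close>.\<close>
  have "u (?f * p k) = k_c p k / k_c p n * h_c u p n"
    unfolding f using Suc degree_pCons_le[of 0 "p k"]
    by (subst functional_lead) (simp_all add: degree_p k_c_def)
  then have "u (?f * p k) / h_c u p k = ttr_c u p n"
    by (simp add: ttr_c_def ttr_a_def Suc)
  then show ?thesis using ab(1) a b Suc by simp
qed

end

section \<open>Symmetric functionals and parity\<close>

lemma coeff_pcompose_uminus:
  fixes f :: "'a :: comm_ring_1 poly"
  shows "coeff (f \<circ>\<^sub>p [:0, -1:]) i = (-1) ^ i * coeff f i"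
  by (induction f arbitrary: i)
    (auto simp: pcompose_pCons coeff_pCons algebra_simps split: nat.splits)

text \<open>The two arguments differ only in their odd monomials, on which \<open>v\<close>
  vanishes.\<close>

lemma functional_reflect:
  assumes "moment_functional v" and "\<And>n. v (monom 1 (2 * n + 1)) = 0"
  shows "v (f \<circ>\<^sub>p [:0, -1:]) = v f"
proof -
  note smult = moment_functional_smult[OF assms(1)] and sum = moment_functional_sum[OF assms(1)]
  have "f \<circ>\<^sub>p [:0, -1:] = (\<Sum>i\<le>degree f. monom (coeff f i * (-1) ^ i) i)"
    using poly_as_sum_of_monoms[of "f \<circ>\<^sub>p [:0, -1:]"]
    by (simp add: coeff_pcompose_uminus degree_pcompose mult.commute)
  then have "v (f \<circ>\<^sub>p [:0, -1:]) = (\<Sum>i\<le>degree f. coeff f i * (-1) ^ i * v (monom 1 i))"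
    using smult_monom[of _ "1::real"] by (simp add: sum flip: smult)
  also have "\<dots> = (\<Sum>i\<le>degree f. coeff f i * v (monom 1 i))"
  proof (intro sum.cong refl)
    fix i
    show "coeff f i * (-1) ^ i * v (monom 1 i) = coeff f i * v (monom 1 i)"
    proof (cases "even i")
      case False
      then obtain n where "i = 2 * n + 1" by (auto elim: oddE)
      then show ?thesis using assms(2)[of n] by simp
    qed simp
  qed
  also have "\<dots> = v (\<Sum>i\<le>degree f. monom (coeff f i) i)"
    using smult_monom[of _ "1::real"] by (simp add: sum flip: smult)
  finally show ?thesis by (simp add: poly_as_sum_of_monoms)
qed

text \<open>The reflection of \<open>q m\<close>, with sign \<open>(-1) ^ m\<close>, has the same
  leading coefficient as \<open>q m\<close> and is also orthogonal to all earlier members. The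
  difference \<open>r\<close> of the two thus has lower degree and is orthogonal to everything of
  that degree, so it is zero.\<close>

lemma symmetric_ops_parity:
  assumes "symmetric_functional v" and "ops v q" and "coeff (q m) k \<noteq> 0"
  shows "even (m + k)"
proof -
  have mf: "moment_functional v" and odd: "\<And>n. v (monom 1 (2 * n + 1)) = 0"
    using assms(1) by (auto simp: symmetric_functional_def quasi_definite_def)
  interpret orthogonal_sequence v q by unfold_locales fact+
  let ?R = "\<lambda>f. f \<circ>\<^sub>p [:0, -1 :: real:]"
  have deg_R: "degree (?R f) = degree f" for f
    by (simp add: degree_pcompose)
  have RR: "?R (?R f) = f" for f
    by (rule poly_eqI) (simp add: coeff_pcompose_uminus flip: mult.assoc power_add)
  define r where "r = q m - Polynomial.smult ((-1) ^ m) (?R (q m))"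
  have deg: "coeff r i = 0" if "i \<ge> m" for i
  proof (cases "i = m")
    case True
    then show ?thesis by (simp add: r_def coeff_pcompose_uminus flip: mult.assoc power_add)
  next
    case False
    then show ?thesis using that by (simp add: r_def coeff_pcompose_uminus coeff_above)
  qed
  have orth: "v (r * q j) = 0" if "j < m" for j
  proof -
    \<comment> \<open>Invariance of \<open>v\<close> moves the reflection over to
      \<open>q j\<close>, whose degree it preserves.\<close>
    have "v (?R (q m) * q j) = v (?R (?R (q m) * q j))"
      by (simp only: functional_reflect[OF mf odd])
    also have "\<dots> = v (q m * ?R (q j))" by (simp add: pcompose_mult RR)
    also have "\<dots> = 0" using that by (intro functional_lower) (simp add: deg_R degree_p)
    finally have "v (?R (q m) * q j) = 0" .
    moreover have "v (q m * q j) = 0" using that by (simp add: orthogonal)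
    ultimately show ?thesis
      by (simp add: r_def left_diff_distrib functional_diff functional_smult)
  qed
  have "r = 0"
  proof (cases m)
    case 0
    then show ?thesis using deg by (intro poly_eqI) simp
  next
    case (Suc n)
    have "degree r \<le> n" using deg Suc by (intro degree_le) auto
    then have "r = (\<Sum>j\<le>n. Polynomial.smult (v (r * q j) / h_c v q j) (q j))" by (rule expansion)
    also have "\<dots> = 0" using orth Suc by (intro sum.neutral) auto
    finally show ?thesis .
  qed
  then have "coeff (q m) k = (-1) ^ m * ((-1) ^ k * coeff (q m) k)"
    unfolding r_def by (metis coeff_pcompose_uminus coeff_smult eq_iff_diff_eq_0)
  then show ?thesis using assms(3) by (cases "even (m + k)") (simp_all flip: mult.assoc power_add)
qed

section \<open>Bivariate polynomials and their values\<close>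

lemma poly2_eq_poly_map_poly:
  "poly (poly P [:y:]) x = poly (map_poly (\<lambda>c. poly c x) P) y"
  for x y :: "'a :: comm_ring_1"
  by (induction P) (simp_all add: map_poly_pCons)

text \<open>For fixed \<open>x\<close> both sides are polynomials in y, so each of their
  coefficients, a polynomial in x, agrees at infinitely many points. This allows the zeros of
  \<open>\<rho>\<close> to be left out later.\<close>

lemma poly2_eqI:
  fixes P Q :: "real poly poly"
  assumes "infinite X" and eq: "\<And>x y. x \<in> X \<Longrightarrow> poly (poly P [:y:]) x = poly (poly Q [:y:]) x"
  shows "P = Q"
proof (rule poly_eqI)
  fix k
  have "poly (coeff P k) x = poly (coeff Q k) x" if "x \<in> X" for x
  proof -
    have "map_poly (\<lambda>c. poly c x) P = map_poly (\<lambda>c. poly c x) Q"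
      using eq[OF that] by (intro iffD1[OF poly_eq_poly_eq_iff] ext) (simp add: poly2_eq_poly_map_poly)
    then have "coeff (map_poly (\<lambda>c. poly c x) P) k = coeff (map_poly (\<lambda>c. poly c x) Q) k" by simp
    then show ?thesis by (simp add: coeff_map_poly)
  qed
  then have "X \<subseteq> {x. poly (coeff P k - coeff Q k) x = 0}" by auto
  then have "infinite {x. poly (coeff P k - coeff Q k) x = 0}"
    using assms(1) infinite_super by blast
  then show "coeff P k = coeff Q k" using poly_roots_finite[of "coeff P k - coeff Q k"] by auto
qed

section \<open>Passing between neighbouring weights\<close>

text \<open>Pairing \<open>p m n\<close> with \<open>p (m + 1) j\<close> under
  \<open>u (m + 1)\<close> is pairing it under \<open>u m\<close> with a polynomial of degree at
  most \<open>j + 2\<close>; this vanishes for \<open>j + 2 < n\<close>.\<close>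

lemma connection_expansion:
  assumes p: "orthogonal_sequence (u m) (p m)" and p': "orthogonal_sequence (u (m + 1)) (p (m + 1))"
    and u: "\<And>f. u (m + 1) f = u m ([:s0, s1, s2:] * f)"
  shows "p m n = Polynomial.smult (delta_c p m n) (p (m + 1) n)
    + (if n < 1 then 0 else Polynomial.smult (eps_c p m n) (p (m + 1) (n - 1)))
    + (if n < 2 then 0 else Polynomial.smult (zeta_c s2 u p m n) (p (m + 1) (n - 2)))"
proof -
  interpret a: orthogonal_sequence "u m" "p m" by (rule p)
  interpret b: orthogonal_sequence "u (m + 1)" "p (m + 1)" by (rule p')
  \<comment> \<open>The full band from \<open>n - 2\<close> to \<open>n\<close> exists only for
    \<open>n \<ge> 2\<close>; the two shorter expansions are done by hand.\<close>
  consider "n = 0" | "n = 1" | k where "n = k + 2"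
    by (metis One_nat_def Suc_1 add.commute add_2_eq_Suc not0_implies_Suc)
  then show ?thesis
  proof cases
    case 1
    obtain c d where "p m 0 = [:c:]" "p (m + 1) 0 = [:d:]"
      using a.degree_p[of 0] b.degree_p[of 0] by (meson degree_eq_zeroE)
    then show ?thesis using 1 b.lead_nonzero[of 0] by (simp add: delta_c_def k_c_def)
  next
    case 2
    have "degree (p m 1) \<le> 1" by (simp only: a.degree_p)
    then obtain c d where cd: "p m 1 = Polynomial.smult c (p (m + 1) 1) + Polynomial.smult d (p (m + 1) 0)"
      "coeff (p m 1) 1 = c * k_c (p (m + 1)) 1"
      "coeff (p m 1) 0 = c * l_c (p (m + 1)) 1 + d * k_c (p (m + 1)) 0"
      by (rule b.expansion_linear)
    have c: "c = delta_c p m 1"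
      using cd(2) b.lead_nonzero[of 1] by (simp add: delta_c_def k_c_def field_simps)
    have "d = (coeff (p m 1) 0 - c * l_c (p (m + 1)) 1) / k_c (p (m + 1)) 0"
      using cd(3) b.lead_nonzero[of 0] by (simp add: field_simps)
    then have "d = eps_c p m 1"
      by (simp add: eps_c_def c delta_c_def l_c_def diff_divide_distrib)
    then show ?thesis using cd(1) c 2 by simp
  next
    case 3
    have S: "u (m + 1) (p m n * p (m + 1) j) = u m (p m n * ([:s0, s1, s2:] * p (m + 1) j))" for j
      unfolding u by (simp only: mult.left_commute mult.commute)
    have dS: "degree ([:s0, s1, s2:] * p (m + 1) j) \<le> j + 2" for j
      using degree_mult_le[of "[:s0, s1, s2:]" "p (m + 1) j"] b.degree_p[of j]
      by (simp add: numeral_2_eq_2 split: if_splits)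
    have deg: "degree (p m n) \<le> k + 2" using 3 by (simp add: a.degree_p)
    have "u (m + 1) (p m n * p (m + 1) j) = 0" if "j < k" for j
      unfolding S using that 3 dS[of j] by (intro a.functional_lower) simp
    then obtain c d where cd: "p m n = Polynomial.smult c (p (m + 1) (k + 2))
        + Polynomial.smult d (p (m + 1) (k + 1))
        + Polynomial.smult (u (m + 1) (p m n * p (m + 1) k) / h_c (u (m + 1)) (p (m + 1)) k) (p (m + 1) k)"
      "coeff (p m n) (k + 2) = c * k_c (p (m + 1)) (k + 2)"
      "coeff (p m n) (k + 1) = c * l_c (p (m + 1)) (k + 2) + d * k_c (p (m + 1)) (k + 1)"
      using b.band_expansion[OF deg] by blast
    have c: "c = delta_c p m n"
      using cd(2) 3 b.lead_nonzero[of "k + 2"] by (simp add: delta_c_def k_c_def field_simps)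
    have "d = (coeff (p m n) (k + 1) - c * l_c (p (m + 1)) (k + 2)) / k_c (p (m + 1)) (k + 1)"
      using cd(3) b.lead_nonzero[of "k + 1"] by (simp add: field_simps)
    then have d: "d = eps_c p m n"
      by (simp add: eps_c_def c delta_c_def l_c_def 3 diff_divide_distrib)
    \<comment> \<open>The lowest component is the borderline pairing \<open>j = n - 2\<close>, where
      only the leading coefficient counts. This is the origin of \<open>s2\<close> in
      \<open>zeta_c\<close>.\<close>
    have "coeff ([:s0, s1, s2:] * p (m + 1) k) n = s2 * k_c (p (m + 1)) k"
      using 3 b.coeff_above[of k] by (simp add: k_c_def)
    then have "u (m + 1) (p m n * p (m + 1) k) / h_c (u (m + 1)) (p (m + 1)) k = zeta_c s2 u p m n"
      unfolding S using dS[of k] 3 by (subst a.functional_lead) (simp_all add: zeta_c_def)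
    then show ?thesis using cd(1) c d 3 by simp
  qed
qed

text \<open>Dual to \<open>connection_expansion\<close>: the square of \<open>\<rho>\<close> is
  absorbed into \<open>u (m + 1)\<close>, so the components come from the same pairings, divided by
  the norms of the \<open>p m\<close> instead of the \<open>p (m + 1)\<close>.\<close>

lemma rho_square_expansion:
  assumes p: "orthogonal_sequence (u m) (p m)" and p': "orthogonal_sequence (u (m + 1)) (p (m + 1))"
    and u: "\<And>f. u (m + 1) f = u m ([:s0, s1, s2:] * f)"
  shows "[:s0, s1, s2:] * p (m + 1) n = Polynomial.smult (eta_c s2 p m n) (p m (n + 2))
    + Polynomial.smult (theta_c u p m n) (p m (n + 1)) + Polynomial.smult (vartheta_c u p m n) (p m n)"
proof -
  interpret a: orthogonal_sequence "u m" "p m" by (rule p)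
  interpret b: orthogonal_sequence "u (m + 1)" "p (m + 1)" by (rule p')
  let ?f = "[:s0, s1, s2:] * p (m + 1) n"
  have S: "u m (?f * p m j) = u (m + 1) (p (m + 1) n * p m j)" for j
    unfolding u by (simp only: mult.assoc)
  have deg: "degree ?f \<le> n + 2"
    using degree_mult_le[of "[:s0, s1, s2:]" "p (m + 1) n"] b.degree_p[of n]
    by (simp add: numeral_2_eq_2 split: if_splits)
  have "u m (?f * p m j) = 0" if "j < n" for j
    unfolding S using that by (intro b.functional_lower) (simp add: a.degree_p)
  then obtain c d where cd: "?f = Polynomial.smult c (p m (n + 2)) + Polynomial.smult d (p m (n + 1))
      + Polynomial.smult (u m (?f * p m n) / h_c (u m) (p m) n) (p m n)"
    "d = u m (?f * p m (n + 1)) / h_c (u m) (p m) (n + 1)"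
    "coeff ?f (n + 2) = c * k_c (p m) (n + 2)"
    using a.band_expansion[OF deg] by blast
  have "coeff ?f (n + 2) = s2 * k_c (p (m + 1)) n"
    using b.coeff_above[of n] by (simp add: k_c_def)
  then have c: "c = eta_c s2 p m n"
    using cd(3) a.lead_nonzero[of "n + 2"] by (simp add: eta_c_def field_simps)
  have "u (m + 1) (p (m + 1) n * p m n) = delta_c p m n * h_c (u (m + 1)) (p (m + 1)) n"
    by (subst b.functional_lead) (simp_all add: a.degree_p delta_c_def k_c_def)
  then have e: "u m (?f * p m n) / h_c (u m) (p m) n = vartheta_c u p m n"
    unfolding S by (simp add: vartheta_c_def)
  \<comment> \<open>Of the expansion of \<open>p m (n + 1)\<close>, only the term along
    \<open>p (m + 1) n\<close> survives, and its coefficient is \<open>eps_c\<close> at the shifted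
    index.\<close>
  have "u (m + 1) (p (m + 1) n * p m (n + 1)) = eps_c p m (n + 1) * h_c (u (m + 1)) (p (m + 1)) n"
    by (subst connection_expansion[OF p p' u])
      (auto simp: distrib_left b.functional_add b.functional_smult b.orthogonal b.functional_0 b.norm_eq
        simp del: One_nat_def)
  then have d: "d = theta_c u p m n"
    unfolding cd(2) S by (simp add: theta_c_def)
  show ?thesis using cd(1) unfolding c d e .
qed

section \<open>Rows of tridiagonal products\<close>

lemma const_mat_mult_vec:
  assumes "M \<in> carrier_mat nr nc" and "i < nr"
  shows "(const_mat M *\<^sub>v vec nc f) $ i = (\<Sum>j<nc. Polynomial.smult [:M $$ (i, j):] (f j))"
  using assms by (auto simp: const_mat_def scalar_prod_def lessThan_atLeast0 intro!: sum.cong)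

text \<open>The bounds on the columns are kept because the matrices have \<open>n + 1\<close> rows
  but \<open>n + 2\<close>, \<open>n + 1\<close> and \<open>n\<close> columns.\<close>

lemma tridiag_mat_mult_vec:
  assumes "i < nr"
  shows "(const_mat (tridiag_mat nr nc e1 e2 e3) *\<^sub>v vec nc f) $ i =
    (if 0 < i \<and> i - 1 < nc then Polynomial.smult [:e1 i:] (f (i - 1)) else 0)
    + (if i < nc then Polynomial.smult [:e2 i:] (f i) else 0)
    + (if i + 1 < nc then Polynomial.smult [:e3 i:] (f (i + 1)) else 0)"
proof -
  have "(const_mat (tridiag_mat nr nc e1 e2 e3) *\<^sub>v vec nc f) $ i =
    (\<Sum>j<nc. Polynomial.smult [:tridiag_mat nr nc e1 e2 e3 $$ (i, j):] (f j))"
    using assms by (intro const_mat_mult_vec[where nr = nr]) (simp_all add: tridiag_mat_def)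
  \<comment> \<open>The inner test \<open>0 < i\<close> is there for row 0, where truncated
    \<open>i - 1\<close> would count the diagonal entry a second time.\<close>
  also have "\<dots> =
    (\<Sum>j<nc. (if j = i - 1 then if 0 < i then Polynomial.smult [:e1 i:] (f j) else 0 else 0)
      + (if j = i then Polynomial.smult [:e2 i:] (f j) else 0)
      + (if j = i + 1 then Polynomial.smult [:e3 i:] (f j) else 0))"
    using assms by (intro sum.cong) (auto simp: tridiag_mat_def)
  finally show ?thesis by (simp add: sum.distrib)
qed

section \<open>The bivariate system and its relation\<close>

text \<open>Explicit form of \<open>P_poly\<close>: multiplying \<open>\<rho>\<close> to the power
  \<open>m\<close> into \<open>q m\<close> clears every denominator and leaves \<open>\<rho>\<close>
  to the power \<open>m - k\<close> beside \<open>y\<close> to the power \<open>k\<close>.\<close>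

definition biv :: "(nat \<Rightarrow> real poly) \<Rightarrow> (nat \<Rightarrow> nat \<Rightarrow> real poly) \<Rightarrow> (nat \<Rightarrow> real poly) \<Rightarrow>
    nat \<Rightarrow> nat \<Rightarrow> real poly poly" where
  "biv R p q n m = (\<Sum>k\<le>m. monom (Polynomial.smult (coeff (q m) k) (R (m - k) * p m (n - m))) k)"

text \<open>\<open>R j\<close> stands for \<open>\<rho>\<^sup>j\<close>, but need only equal it where \<open>y\<^sup>k\<close> with \<open>k = m - j\<close> occurs in some \<open>q m\<close>:
  if \<open>\<rho>\<close> is the square root of a polynomial, only even powers of \<open>\<rho>\<close> are polynomials.
  The assumption \<open>diag\<close> abstracts from the two cases: in case I it is a multiple of the recurrence of \<open>p i\<close>,
  in case II both sides vanish.\<close>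

locale koornwinder =
  fixes \<rho> :: "real \<Rightarrow> complex" and s2 s1 s0 :: real
    and u :: "nat \<Rightarrow> real poly \<Rightarrow> real" and p :: "nat \<Rightarrow> nat \<Rightarrow> real poly"
    and v :: "real poly \<Rightarrow> real" and q :: "nat \<Rightarrow> real poly"
    and R :: "nat \<Rightarrow> real poly" and dA dB dC :: "nat \<Rightarrow> nat \<Rightarrow> real"
  assumes rho2: "\<And>x. (\<rho> x)\<^sup>2 = of_real (poly [:s0, s1, s2:] x)"
    and rho2_nonzero: "[:s0, s1, s2:] \<noteq> 0"
    and u: "\<And>m f. u (m + 1) f = u m ([:s0, s1, s2:] * f)"
    and p: "\<And>m. orthogonal_sequence (u m) (p m)"
    and q: "orthogonal_sequence v q"
    and R_0: "R 0 = 1"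
    and R: "\<And>m k x. k \<le> m \<Longrightarrow> coeff (q m) k \<noteq> 0 \<Longrightarrow> of_real (poly (R (m - k)) x) = \<rho> x ^ (m - k)"
    and diag: "\<And>i j x. of_real (ttr_b q i) * \<rho> x * of_real (poly (p i j) x) =
      of_real (dA i j * poly (p i (j + 1)) x + dB i j * poly (p i j) x
        + (if j = 0 then 0 else dC i j * poly (p i (j - 1)) x))"
begin

text \<open>\<open>\<rho>\<close> vanishes only where its square does, and the square is a nonzero
  polynomial.\<close>

lemma infinite_rho_nonzero: "infinite {x. \<rho> x \<noteq> 0}"
proof -
  have "{x. \<rho> x \<noteq> 0} = - {x. poly [:s0, s1, s2:] x = 0}"
    using rho2 by (auto simp del: poly_pCons) (metis of_real_eq_0_iff zero_eq_power2)+
  moreover have "finite {x. poly [:s0, s1, s2:] x = 0}"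
    by (rule poly_roots_finite[OF rho2_nonzero])
  ultimately show ?thesis by (simp add: finite_compl infinite_UNIV_char_0 Compl_eq_Diff_UNIV del: poly_pCons)
qed

abbreviation val :: "real poly poly \<Rightarrow> real \<Rightarrow> real \<Rightarrow> complex" where
  "val P x y \<equiv> of_real (poly (poly P [:y:]) x)"

abbreviation Q :: "nat \<Rightarrow> complex \<Rightarrow> complex" where
  "Q m z \<equiv> poly (map_poly of_real (q m)) z"

lemma biv_eqI:
  assumes "\<And>x y. \<rho> x \<noteq> 0 \<Longrightarrow> val P x y = val P' x y"
  shows "P = P'"
  using assms by (intro poly2_eqI[OF infinite_rho_nonzero]) (simp only: mem_Collect_eq of_real_eq_iff)

lemma val_biv:
  assumes "\<rho> x \<noteq> 0"
  shows "val (biv R p q n m) x y = of_real (poly (p m (n - m)) x) * \<rho> x ^ m * Q m (of_real y / \<rho> x)"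
proof -
  interpret q: orthogonal_sequence v q by (rule q)
  have "val (biv R p q n m) x y =
      (\<Sum>k\<le>m. of_real (coeff (q m) k) * of_real (poly (R (m - k)) x) * of_real (poly (p m (n - m)) x) * of_real y ^ k)"
    by (simp add: biv_def poly_sum poly_monom poly_power mult.assoc)
  also have "\<dots> = (\<Sum>k\<le>m. of_real (poly (p m (n - m)) x) * \<rho> x ^ m * (of_real (coeff (q m) k) * (of_real y / \<rho> x) ^ k))"
  proof (intro sum.cong refl)
    fix k assume "k \<in> {..m}"
    then have "k \<le> m" by simp
    then have "\<rho> x ^ m = \<rho> x ^ (m - k) * \<rho> x ^ k" by (simp flip: power_add)
    \<comment> \<open>If the coefficient of \<open>q m\<close> is zero, nothing is known about
      \<open>R (m - k)\<close>, but then both sides vanish.\<close>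
    then show "of_real (coeff (q m) k) * of_real (poly (R (m - k)) x) * of_real (poly (p m (n - m)) x) * of_real y ^ k
      = of_real (poly (p m (n - m)) x) * \<rho> x ^ m * (of_real (coeff (q m) k) * (of_real y / \<rho> x) ^ k)"
      using R[OF \<open>k \<le> m\<close>, of x] assms by (cases "coeff (q m) k = 0") (simp_all add: power_divide)
  qed
  also have "\<dots> = of_real (poly (p m (n - m)) x) * \<rho> x ^ m * Q m (of_real y / \<rho> x)"
    by (simp add: poly_altdef coeff_map_poly degree_map_poly q.degree_p sum_distrib_left)
  finally show ?thesis .
qed

text \<open>Justifies the definite description: \<open>val_biv\<close> gives existence,
  \<open>biv_eqI\<close> uniqueness.\<close>

lemma P_poly_eq: "P_poly \<rho> p q n m = biv R p q n m"
  unfolding P_poly_def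
proof (rule the_equality)
  fix P
  assume "\<forall>x y. \<rho> x \<noteq> 0 \<longrightarrow>
    val P x y = of_real (poly (p m (n - m)) x) * \<rho> x ^ m * Q m (of_real y / \<rho> x)"
  then show "P = biv R p q n m" by (intro biv_eqI) (simp add: val_biv)
qed (simp add: val_biv)

text \<open>The argument is complex because \<open>\<rho>\<close>, and hence y divided by it, need
  not be real.\<close>

lemma Q_recurrence:
  "z * Q m z = of_real (ttr_a q m) * Q (m + 1) z + of_real (ttr_b q m) * Q m z
    + (if m = 0 then 0 else of_real (ttr_c v q m) * Q (m - 1) z)"
proof -
  interpret q: orthogonal_sequence v q by (rule q)
  have hom: "map_poly of_real (f + g) = map_poly of_real f + map_poly (of_real :: real \<Rightarrow> complex) g"
    "map_poly of_real (Polynomial.smult c f) = Polynomial.smult (of_real c) (map_poly (of_real :: real \<Rightarrow> complex) f)"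
    "map_poly of_real (pCons c f) = pCons (of_real c) (map_poly (of_real :: real \<Rightarrow> complex) f)" for f g c
    by (intro poly_eqI; simp add: coeff_map_poly coeff_pCons split: nat.splits)+
  show ?thesis
    using arg_cong[OF q.three_term_recurrence[of m], of "\<lambda>f. poly (map_poly of_real f) z"]
    by (simp add: hom split: if_splits)
qed

text \<open>The terms are grouped and guarded like row \<open>i\<close> of the three matrices. The
  \<open>vartheta_c\<close> term is guarded by \<open>0 < i\<close> alone, so it is present for
  \<open>i = n\<close> too, in the last row of \<open>C2_mat\<close>.\<close>

lemma mult_y_biv:
  assumes "i \<le> n"
  shows "[:0, 1:] * biv R p q n i =
    ((if 0 < i then Polynomial.smult [:ttr_c v q i * eta_c s2 p (i - 1) (n - i):] (biv R p q (n + 1) (i - 1)) else 0)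
    + Polynomial.smult [:dA i (n - i):] (biv R p q (n + 1) i)
    + Polynomial.smult [:ttr_a q i * delta_c p i (n - i):] (biv R p q (n + 1) (i + 1)))
    + ((if 0 < i then Polynomial.smult [:ttr_c v q i * theta_c u p (i - 1) (n - i):] (biv R p q n (i - 1)) else 0)
    + Polynomial.smult [:dB i (n - i):] (biv R p q n i)
    + (if i < n then Polynomial.smult [:ttr_a q i * eps_c p i (n - i):] (biv R p q n (i + 1)) else 0))
    + ((if 0 < i then Polynomial.smult [:ttr_c v q i * vartheta_c u p (i - 1) (n - i):] (biv R p q (n - 1) (i - 1)) else 0)
    + (if i < n then Polynomial.smult [:dC i (n - i):] (biv R p q (n - 1) i) else 0)
    + (if i + 1 < n then Polynomial.smult [:ttr_a q i * zeta_c s2 u p i (n - i):] (biv R p q (n - 1) (i + 1)) else 0))"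
    (is "?L = ?A + ?B + ?C")
proof (rule biv_eqI)
  fix x y assume x: "\<rho> x \<noteq> 0"
  define j where "j = n - i"
  have n: "n = i + j" using assms by (simp add: j_def)
  define r where "r = \<rho> x"
  have r: "r \<noteq> 0" using x by (simp add: r_def)
  define z where "z = of_real y / r"
  have y: "of_real y = z * r" using r by (simp add: z_def)
  define pp where "pp i j = (of_real (poly (p i j) x) :: complex)" for i j
  have val: "val (biv R p q n m) x y = pp m (n - m) * r ^ m * Q m z" for n m
    using val_biv[OF x] by (simp add: pp_def r_def z_def)
  have up: "pp i j = of_real (delta_c p i j) * pp (i + 1) j
    + (if j < 1 then 0 else of_real (eps_c p i j) * pp (i + 1) (j - 1))
    + (if j < 2 then 0 else of_real (zeta_c s2 u p i j) * pp (i + 1) (j - 2))"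
    unfolding pp_def by (subst connection_expansion[of u i p, OF p p u]) simp
  have mid: "of_real (ttr_b q i) * r * pp i j = of_real (dA i j) * pp i (j + 1) + of_real (dB i j) * pp i j
     + (if j = 0 then 0 else of_real (dC i j) * pp i (j - 1))"
    using diag[of i x j] by (simp add: pp_def r_def)
  have down: "r\<^sup>2 * pp i j = of_real (eta_c s2 p (i - 1) j) * pp (i - 1) (j + 2)
     + of_real (theta_c u p (i - 1) j) * pp (i - 1) (j + 1) + of_real (vartheta_c u p (i - 1) j) * pp (i - 1) j"
    if "0 < i"
  proof -
    have "r\<^sup>2 * pp i j = of_real (poly ([:s0, s1, s2:] * p (i - 1 + 1) j) x)"
      unfolding pp_def r_def rho2 using that by (simp add: algebra_simps)
    then show ?thesis unfolding rho_square_expansion[of u "i - 1" p, OF p p u] pp_def by simp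
  qed
  have "val ?L x y = of_real y * (pp i j * r ^ i * Q i z)"
    using val[of n i] by (simp add: j_def)
  also have "\<dots> = pp i j * r ^ (i + 1) * (z * Q i z)"
    by (simp add: y)
  \<comment> \<open>Each part needs as many powers of \<open>r\<close> as the index of its
    \<open>Q\<close>: the first uses all \<open>i + 1\<close>, the second spares one for
    \<open>mid\<close>, the third spares two for \<open>down\<close>.\<close>
  also have "\<dots> = of_real (ttr_a q i) * pp i j * (r ^ (i + 1) * Q (i + 1) z)
    + of_real (ttr_b q i) * r * pp i j * (r ^ i * Q i z)
    + (if i = 0 then 0 else of_real (ttr_c v q i) * (r\<^sup>2 * pp i j) * (r ^ (i - 1) * Q (i - 1) z))"
    unfolding Q_recurrence[of z i] by (cases i) (simp_all add: algebra_simps power2_eq_square)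
  \<comment> \<open>As \<open>n = i + j\<close>, the degrees \<open>j\<close>, \<open>j - 1\<close>,
    \<open>j - 2\<close> in x beside index \<open>i + 1\<close> belong to the families
    \<open>n + 1\<close>, \<open>n\<close>, \<open>n - 1\<close>.\<close>
  also have "of_real (ttr_a q i) * pp i j * (r ^ (i + 1) * Q (i + 1) z) =
      val (Polynomial.smult [:ttr_a q i * delta_c p i (n - i):] (biv R p q (n + 1) (i + 1))) x y
      + val (if i < n then Polynomial.smult [:ttr_a q i * eps_c p i (n - i):] (biv R p q n (i + 1)) else 0) x y
      + val (if i + 1 < n then Polynomial.smult [:ttr_a q i * zeta_c s2 u p i (n - i):] (biv R p q (n - 1) (i + 1)) else 0) x y"
    by (subst up) (auto simp: val n distrib_left distrib_right numeral_2_eq_2 mult_ac)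
  also have "of_real (ttr_b q i) * r * pp i j * (r ^ i * Q i z) =
      val (Polynomial.smult [:dA i (n - i):] (biv R p q (n + 1) i)) x y
      + val (Polynomial.smult [:dB i (n - i):] (biv R p q n i)) x y
      + val (if i < n then Polynomial.smult [:dC i (n - i):] (biv R p q (n - 1) i) else 0) x y"
    unfolding mid by (auto simp: val n distrib_left distrib_right mult_ac)
  also have "(if i = 0 then 0 else of_real (ttr_c v q i) * (r\<^sup>2 * pp i j) * (r ^ (i - 1) * Q (i - 1) z)) =
      val (if 0 < i then Polynomial.smult [:ttr_c v q i * eta_c s2 p (i - 1) (n - i):] (biv R p q (n + 1) (i - 1)) else 0) x y
      + val (if 0 < i then Polynomial.smult [:ttr_c v q i * theta_c u p (i - 1) (n - i):] (biv R p q n (i - 1)) else 0) x y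
      + val (if 0 < i then Polynomial.smult [:ttr_c v q i * vartheta_c u p (i - 1) (n - i):] (biv R p q (n - 1) (i - 1)) else 0) x y"
  proof (cases i)
    case (Suc k)
    \<comment> \<open>With the lowered index \<open>k = i - 1\<close>, the same three families have
      degrees \<open>j + 2\<close>, \<open>j + 1\<close>, \<open>j\<close> in x.\<close>
    then have "n + 1 - k = j + 2" "n - k = j + 1" "n - 1 - k = j" "n - i = j" using n by auto
    then show ?thesis using Suc down by (simp add: val distrib_left distrib_right mult_ac)
  qed simp
  \<comment> \<open>The nine terms, so far sorted by the index of \<open>Q\<close>, are re-sorted by
    family.\<close>
  also have "val (Polynomial.smult [:ttr_a q i * delta_c p i (n - i):] (biv R p q (n + 1) (i + 1))) x y
      + val (if i < n then Polynomial.smult [:ttr_a q i * eps_c p i (n - i):] (biv R p q n (i + 1)) else 0) x y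
      + val (if i + 1 < n then Polynomial.smult [:ttr_a q i * zeta_c s2 u p i (n - i):] (biv R p q (n - 1) (i + 1)) else 0) x y
      + (val (Polynomial.smult [:dA i (n - i):] (biv R p q (n + 1) i)) x y
      + val (Polynomial.smult [:dB i (n - i):] (biv R p q n i)) x y
      + val (if i < n then Polynomial.smult [:dC i (n - i):] (biv R p q (n - 1) i) else 0) x y)
      + (val (if 0 < i then Polynomial.smult [:ttr_c v q i * eta_c s2 p (i - 1) (n - i):] (biv R p q (n + 1) (i - 1)) else 0) x y
      + val (if 0 < i then Polynomial.smult [:ttr_c v q i * theta_c u p (i - 1) (n - i):] (biv R p q n (i - 1)) else 0) x y
      + val (if 0 < i then Polynomial.smult [:ttr_c v q i * vartheta_c u p (i - 1) (n - i):] (biv R p q (n - 1) (i - 1)) else 0) x y)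
    = val (?A + ?B + ?C) x y"
    by (simp only: poly_add of_real_add add_ac)
  finally show "val ?L x y = val (?A + ?B + ?C) x y" .
qed

lemma PP_eq: "PP \<rho> p q n = vec (n + 1) (biv R p q n)"
  by (simp add: PP_def P_poly_eq)

text \<open>For \<open>n = 0\<close> the vector is empty, so truncation in \<open>n - 1\<close> is
  harmless.\<close>

lemma PP_prev_eq: "PP_prev \<rho> p q n = vec n (biv R p q (n - 1))"
  by (auto simp: PP_prev_def PP_eq)

lemma relation_iff_rows:
  assumes "A \<in> carrier_mat (n + 1) (n + 2)" "B \<in> carrier_mat (n + 1) (n + 1)" "C \<in> carrier_mat (n + 1) n"
  shows "second_three_term_relation \<rho> p q n A B C \<longleftrightarrow>
    (\<forall>i\<le>n. [:0, 1:] * biv R p q n i =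
      (const_mat A *\<^sub>v vec (n + 2) (biv R p q (n + 1))) $ i
      + (const_mat B *\<^sub>v vec (n + 1) (biv R p q n)) $ i
      + (const_mat C *\<^sub>v vec n (biv R p q (n - 1))) $ i)"
  using assms unfolding second_three_term_relation_def PP_eq PP_prev_eq
  by (auto simp: vec_eq_iff const_mat_def less_Suc_eq_le simp del: index_mult_mat_vec)

lemma relation_holds:
  "second_three_term_relation \<rho> p q n (A2_mat s2 p v q n (\<lambda>m. dA m (n - m)))
     (B2_mat u p v q n (\<lambda>m. dB m (n - m))) (C2_mat s2 u p v q n (\<lambda>m. dC m (n - m)))"
proof (subst relation_iff_rows)
  show "\<forall>i\<le>n. [:0, 1:] * biv R p q n i =
      (const_mat (A2_mat s2 p v q n (\<lambda>m. dA m (n - m))) *\<^sub>v vec (n + 2) (biv R p q (n + 1))) $ i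
      + (const_mat (B2_mat u p v q n (\<lambda>m. dB m (n - m))) *\<^sub>v vec (n + 1) (biv R p q n)) $ i
      + (const_mat (C2_mat s2 u p v q n (\<lambda>m. dC m (n - m))) *\<^sub>v vec n (biv R p q (n - 1))) $ i"
  proof (intro allI impI)
    fix i assume i: "i \<le> n"
    \<comment> \<open>For \<open>i \<le> n\<close> the guards of \<open>tridiag_mat_mult_vec\<close>
      reduce to those of \<open>mult_y_biv\<close>.\<close>
    then have "0 < i \<and> i - 1 < n + 2 \<longleftrightarrow> 0 < i" "0 < i \<and> i - 1 < n + 1 \<longleftrightarrow> 0 < i"
      "0 < i \<and> i - 1 < n \<longleftrightarrow> 0 < i" "i < n + 2" "i < n + 1" "i + 1 < n + 2" "i + 1 < n + 1 \<longleftrightarrow> i < n"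
      by auto
    then show "[:0, 1:] * biv R p q n i =
      (const_mat (A2_mat s2 p v q n (\<lambda>m. dA m (n - m))) *\<^sub>v vec (n + 2) (biv R p q (n + 1))) $ i
      + (const_mat (B2_mat u p v q n (\<lambda>m. dB m (n - m))) *\<^sub>v vec (n + 1) (biv R p q n)) $ i
      + (const_mat (C2_mat s2 u p v q n (\<lambda>m. dC m (n - m))) *\<^sub>v vec n (biv R p q (n - 1))) $ i"
      unfolding A2_mat_def B2_mat_def C2_mat_def mult_y_biv[OF i]
      by (simp only: tridiag_mat_mult_vec if_True)
  qed
qed (simp_all add: A2_mat_def B2_mat_def C2_mat_def tridiag_mat_def)

section \<open>Uniqueness of the matrices\<close>

lemma coeff_biv:
  "coeff (biv R p q n m) k =
    (if k \<le> m then Polynomial.smult (coeff (q m) k) (R (m - k) * p m (n - m)) else 0)"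
  by (simp add: biv_def coeff_sum)

text \<open>With respect to \<open>y\<close>, \<open>biv R p q N m\<close> has degree \<open>m\<close> and leading coefficient a multiple of \<open>p m (N - m)\<close>;
  so the lexicographically largest \<open>(m, N)\<close> with \<open>c N m \<noteq> 0\<close> contributes a term that cannot cancel.\<close>

lemma biv_independent:
  assumes zero: "(\<Sum>N\<le>M. \<Sum>m\<le>N. Polynomial.smult [:c N m:] (biv R p q N m)) = 0"
    and "N \<le> M" "m \<le> N"
  shows "c N m = 0"
proof (rule ccontr)
  assume nz: "c N m \<noteq> 0"
  interpret q: orthogonal_sequence v q by (rule q)
  define X where "X = {(N, m) \<in> (SIGMA N:{..M}. {..N}). c N m \<noteq> 0}"
  have fin: "finite X"
    by (rule finite_subset[of _ "SIGMA N:{..M}. {..N}"]) (auto simp: X_def)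
  have "(N, m) \<in> X" using assms nz by (simp add: X_def)
  define m0 where "m0 = Max (snd ` X)"
  define Y where "Y = {N. (N, m0) \<in> X}"
  define N0 where "N0 = Max Y"
  have "m0 \<in> snd ` X" unfolding m0_def using fin \<open>(N, m) \<in> X\<close> by (intro Max_in) auto
  then have "Y \<noteq> {}" by (auto simp: Y_def)
  have "Y \<subseteq> fst ` X" by (force simp: Y_def)
  then have "finite Y" using fin finite_surj by blast
  then have "N0 \<in> Y" unfolding N0_def using \<open>Y \<noteq> {}\<close> by (rule Max_in)
  then have X0: "(N0, m0) \<in> X" by (simp add: Y_def)
  have m0: "m' \<le> m0" if "(N', m') \<in> X" for N' m'
    unfolding m0_def using that fin by (intro Max_ge) force+
  have N0: "N' \<le> N0" if "(N', m0) \<in> X" for N'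
    unfolding N0_def using that \<open>finite Y\<close> by (intro Max_ge) (auto simp: Y_def)
  \<comment> \<open>Members with smaller \<open>m\<close> lack this power of y; those with
    \<open>m = m0\<close> and smaller \<open>N\<close> have too low a degree in x, since
    \<open>R 0 = 1\<close>.\<close>
  let ?phi = "\<lambda>N m. coeff (coeff (biv R p q N m) m0) (N0 - m0)"
  have vanish: "c N' m' * ?phi N' m' = 0" if "N' \<le> M" "m' \<le> N'" "(N', m') \<noteq> (N0, m0)" for N' m'
  proof (cases "c N' m' = 0")
    case False
    then have X': "(N', m') \<in> X" using that by (simp add: X_def)
    interpret p: orthogonal_sequence "u m'" "p m'" by (rule p)
    show ?thesis
    proof (cases "m' = m0")
      case True
      then have "N' - m0 < N0 - m0" using N0[of N'] X' that by auto
      then show ?thesis using True p.coeff_above[of "N' - m0"] by (simp add: coeff_biv R_0)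
    next
      case False
      then show ?thesis using m0[OF X'] by (simp add: coeff_biv)
    qed
  qed simp
  have "0 = coeff (coeff (\<Sum>N\<le>M. \<Sum>m\<le>N. Polynomial.smult [:c N m:] (biv R p q N m)) m0) (N0 - m0)"
    unfolding zero by simp
  also have "\<dots> = (\<Sum>N\<le>M. \<Sum>m\<le>N. c N m * ?phi N m)" by (simp add: coeff_sum)
  also have "\<dots> = (\<Sum>(N, m)\<in>(SIGMA N:{..M}. {..N}). c N m * ?phi N m)" by (simp add: sum.Sigma)
  also have "\<dots> = (\<Sum>(N, m)\<in>{(N0, m0)}. c N m * ?phi N m)"
  proof (intro sum.mono_neutral_right ballI)
    fix z assume z: "z \<in> (SIGMA N:{..M}. {..N}) - {(N0, m0)}"
    obtain a b where "z = (a, b)" by (cases z)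
    then show "(case z of (N, m) \<Rightarrow> c N m * ?phi N m) = 0" using z vanish[of a b] by simp
  qed (use X0 in \<open>auto simp: X_def\<close>)
  also have "\<dots> = c N0 m0 * ?phi N0 m0" by simp
  finally have "?phi N0 m0 = 0" using X0 by (simp add: X_def)
  interpret p: orthogonal_sequence "u m0" "p m0" by (rule p)
  show False
    using \<open>?phi N0 m0 = 0\<close> q.lead_nonzero[of m0] p.lead_nonzero[of "N0 - m0"] by (simp add: coeff_biv R_0 k_c_def)
qed

text \<open>Subtracting two relations row by row gives a linear dependence among the members of
  three consecutive families.\<close>

lemma relation_unique:
  assumes A: "A \<in> carrier_mat (n + 1) (n + 2)" "A' \<in> carrier_mat (n + 1) (n + 2)"
    and B: "B \<in> carrier_mat (n + 1) (n + 1)" "B' \<in> carrier_mat (n + 1) (n + 1)"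
    and C: "C \<in> carrier_mat (n + 1) n" "C' \<in> carrier_mat (n + 1) n"
    and rel: "second_three_term_relation \<rho> p q n A B C" "second_three_term_relation \<rho> p q n A' B' C'"
  shows "A = A' \<and> B = B' \<and> C = C'"
proof -
  have entries: "(\<forall>j\<le>n + 1. A $$ (i, j) = A' $$ (i, j)) \<and> (\<forall>j\<le>n. B $$ (i, j) = B' $$ (i, j))
      \<and> (\<forall>j<n. C $$ (i, j) = C' $$ (i, j))" if i: "i \<le> n" for i
  proof -
    define a where "a j = A $$ (i, j) - A' $$ (i, j)" for j
    define b where "b j = B $$ (i, j) - B' $$ (i, j)" for j
    define d where "d j = C $$ (i, j) - C' $$ (i, j)" for j
    have smult: "Polynomial.smult [:x - y:] P = Polynomial.smult [:x:] P - Polynomial.smult [:y:] P"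
      for x y :: real and P :: "real poly poly"
      using smult_diff_left[of "[:x:]" "[:y:]" P] by simp
    have "i < n + 1" using i by simp
    have eq: "(\<Sum>j<n + 2. Polynomial.smult [:M $$ (i, j):] (biv R p q (n + 1) j))
        + (\<Sum>j<n + 1. Polynomial.smult [:M' $$ (i, j):] (biv R p q n j))
        + (\<Sum>j<n. Polynomial.smult [:M'' $$ (i, j):] (biv R p q (n - 1) j)) = [:0, 1:] * biv R p q n i"
      if "M \<in> carrier_mat (n + 1) (n + 2)" "M' \<in> carrier_mat (n + 1) (n + 1)" "M'' \<in> carrier_mat (n + 1) n"
        "second_three_term_relation \<rho> p q n M M' M''" for M M' M''
      using that(4) i unfolding relation_iff_rows[OF that(1-3)]
      by (simp only: const_mat_mult_vec[OF that(1) \<open>i < n + 1\<close>] const_mat_mult_vec[OF that(2) \<open>i < n + 1\<close>]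
          const_mat_mult_vec[OF that(3) \<open>i < n + 1\<close>])
    have diff: "x - x' + (y - y') + (z - z') = 0" if "x + y + z = w" "x' + y' + z' = w"
      for x x' y y' z z' w :: "real poly poly"
      using that by (simp add: algebra_simps)
    have rows: "(\<Sum>j<n + 2. Polynomial.smult [:a j:] (biv R p q (n + 1) j))
      + (\<Sum>j<n + 1. Polynomial.smult [:b j:] (biv R p q n j))
      + (\<Sum>j<n. Polynomial.smult [:d j:] (biv R p q (n - 1) j)) = 0"
      unfolding a_def b_def d_def smult sum_subtractf
      by (rule diff[OF eq[OF A(1) B(1) C(1) rel(1)] eq[OF A(2) B(2) C(2) rel(2)]])
    \<comment> \<open>Collects the three rows of differences into one family, as
      \<open>biv_independent\<close> expects. For \<open>n = 0\<close> no \<open>N\<close> satisfies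
      \<open>N + 1 = n\<close>.\<close>
    define c where "c N j = (if N = n + 1 then a j else if N = n then b j else if N + 1 = n then d j else 0)" for N j
    define T where "T N = (\<Sum>j\<le>N. Polynomial.smult [:c N j:] (biv R p q N j))" for N
    have "T (n + 1) = (\<Sum>j<n + 2. Polynomial.smult [:a j:] (biv R p q (n + 1) j))"
      unfolding T_def by (intro sum.cong) (auto simp: c_def)
    moreover have "T n = (\<Sum>j<n + 1. Polynomial.smult [:b j:] (biv R p q n j))"
      unfolding T_def by (intro sum.cong) (auto simp: c_def)
    moreover have "(\<Sum>N<n. T N) = (\<Sum>j<n. Polynomial.smult [:d j:] (biv R p q (n - 1) j))"
    proof (cases n)
      case (Suc k)
      \<comment> \<open>Families below \<open>n - 1 = k\<close> have coefficient zero.\<close>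
      have "(\<Sum>N<k. T N) = 0"
        unfolding T_def by (intro sum.neutral ballI) (auto simp: c_def Suc)
      moreover have "T k = (\<Sum>j<n. Polynomial.smult [:d j:] (biv R p q (n - 1) j))"
        unfolding T_def by (intro sum.cong) (auto simp: c_def Suc)
      ultimately show ?thesis by (simp add: Suc)
    qed simp
    moreover have "(\<Sum>N\<le>n + 1. T N) = T (n + 1) + T n + (\<Sum>N<n. T N)"
      by (simp add: lessThan_Suc_atMost[symmetric] add_ac)
    ultimately have "(\<Sum>N\<le>n + 1. \<Sum>j\<le>N. Polynomial.smult [:c N j:] (biv R p q N j)) = 0"
      using rows unfolding T_def by simp
    then have c: "c N j = 0" if "N \<le> n + 1" "j \<le> N" for N j
      using biv_independent that by blast
    have "a j = 0" if "j \<le> n + 1" for j using c[of "n + 1" j] that by (simp add: c_def)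
    moreover have "b j = 0" if "j \<le> n" for j using c[of n j] that by (simp add: c_def)
    moreover have "d j = 0" if "j < n" for j using c[of "n - 1" j] that by (cases n) (auto simp: c_def)
    ultimately show ?thesis by (simp add: a_def b_def d_def)
  qed
  show ?thesis
    using A B C entries by (auto intro!: eq_matI simp: less_Suc_eq_le)
qed

lemma relation_iff:
  assumes "A \<in> carrier_mat (n + 1) (n + 2)" "B \<in> carrier_mat (n + 1) (n + 1)" "C \<in> carrier_mat (n + 1) n"
  shows "second_three_term_relation \<rho> p q n A B C \<longleftrightarrow>
    A = A2_mat s2 p v q n (\<lambda>m. dA m (n - m)) \<and>
    B = B2_mat u p v q n (\<lambda>m. dB m (n - m)) \<and>
    C = C2_mat s2 u p v q n (\<lambda>m. dC m (n - m))"
proof -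
  have "A2_mat s2 p v q n d \<in> carrier_mat (n + 1) (n + 2)" "B2_mat u p v q n d \<in> carrier_mat (n + 1) (n + 1)"
    "C2_mat s2 u p v q n d \<in> carrier_mat (n + 1) n" for d
    by (simp_all add: A2_mat_def B2_mat_def C2_mat_def tridiag_mat_def)
  then show ?thesis
    using relation_holds[of n] relation_unique[OF assms(1) _ assms(2) _ assms(3)] by blast
qed

end

section \<open>The two cases for \<open>\<rho>\<close>\<close>

text \<open>Consecutive odd powers of \<open>\<rho>\<close> differ by its square, which is a
  polynomial even if \<open>\<rho>\<close> is not.\<close>

lemma u_m_Suc:
  assumes "\<forall>x. (\<rho> x)\<^sup>2 = of_real (s2 * x\<^sup>2 + s1 * x + s0)"
  shows "u_m \<rho> U (m + 1) f = u_m \<rho> U m ([:s0, s1, s2:] * f)"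
proof -
  have "\<rho> x ^ (2 * (m + 1) + 1) * of_real (poly f x) =
      \<rho> x ^ (2 * m + 1) * of_real (poly ([:s0, s1, s2:] * f) x)" for x
  proof -
    have "\<rho> x ^ (2 * (m + 1) + 1) = \<rho> x ^ (2 * m + 1) * (\<rho> x)\<^sup>2"
      by (simp add: power2_eq_square)
    also have "(\<rho> x)\<^sup>2 = of_real (poly [:s0, s1, s2:] x)"
      using assms by (simp add: algebra_simps power2_eq_square)
    finally show ?thesis by (simp only: poly_mult of_real_mult mult.assoc)
  qed
  then show ?thesis by (simp only: u_m_def rho_pow_functional_def)
qed

theorem theorem4p3:
  fixes \<rho> :: "real \<Rightarrow> complex"
    and U :: "(real \<Rightarrow> complex) \<Rightarrow> real"
    and v :: "real poly \<Rightarrow> real"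
    and s2 s1 s0 :: real
    and p :: "nat \<Rightarrow> nat \<Rightarrow> real poly"
    and q :: "nat \<Rightarrow> real poly"
  assumes "\<forall>x. (\<rho> x)\<^sup>2 = of_real (s2 * x\<^sup>2 + s1 * x + s0)"
    and "\<bar>s2\<bar> + \<bar>s1\<bar> + \<bar>s0\<bar> > 0"
    and "linear_on_rho_space \<rho> U"
    and "quasi_definite (rho_pow_functional \<rho> U 0)"
    and "quasi_definite v"
    and "\<forall>m. quasi_definite (u_m \<rho> U m)"
    and "\<forall>m. ops (u_m \<rho> U m) (p m)"
    and "ops v q"
    and "\<forall>m. p m 0 = 1"
    and "q 0 = 1"
  shows
    "(\<forall>r1 r0. case_I \<rho> r1 r0 \<longrightarrow>
        (\<forall>n. \<forall>A \<in> carrier_mat (n + 1) (n + 2). \<forall>B \<in> carrier_mat (n + 1) (n + 1).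
         \<forall>C \<in> carrier_mat (n + 1) n.
           second_three_term_relation \<rho> p q n A B C \<longleftrightarrow>
             A = A2_mat s2 p v q n (\<lambda>m. ttr_b q m * r1 * ttr_a (p m) (n - m)) \<and>
             B = B2_mat (u_m \<rho> U) p v q n (\<lambda>m. ttr_b q m * (r1 * ttr_b (p m) (n - m) + r0)) \<and>
             C = C2_mat s2 (u_m \<rho> U) p v q n
                   (\<lambda>m. ttr_b q m * r1 * ttr_c (u_m \<rho> U m) (p m) (n - m))))
     \<and>
     (case_II \<rho> v \<longrightarrow>
        (\<forall>n. \<forall>A \<in> carrier_mat (n + 1) (n + 2). \<forall>B \<in> carrier_mat (n + 1) (n + 1).
         \<forall>C \<in> carrier_mat (n + 1) n.
           second_three_term_relation \<rho> p q n A B C \<longleftrightarrow>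
             A = A2_mat s2 p v q n (\<lambda>m. 0) \<and>
             B = B2_mat (u_m \<rho> U) p v q n (\<lambda>m. 0) \<and>
             C = C2_mat s2 (u_m \<rho> U) p v q n (\<lambda>m. 0)))"
proof -
  let ?S = "[:s0, s1, s2:]"
  let ?u = "u_m \<rho> U"
  have rho2: "(\<rho> x)\<^sup>2 = of_real (poly ?S x)" for x
    using assms(1) by (simp add: algebra_simps power2_eq_square)
  have S: "?S \<noteq> 0" using assms(2) by auto
  have u: "?u (m + 1) f = ?u m (?S * f)" for m f
    using assms(1) by (rule u_m_Suc)
  have p: "orthogonal_sequence (?u m) (p m)" for m
    using assms(6,7) by unfold_locales (auto simp: quasi_definite_def)
  have q: "orthogonal_sequence v q"
    using assms(5,8) by unfold_locales (auto simp: quasi_definite_def)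
  show ?thesis
  proof (intro conjI impI allI ballI)
    fix r1 r0 n and A B C :: "real mat"
    assume I: "case_I \<rho> r1 r0"
      and ABC: "A \<in> carrier_mat (n + 1) (n + 2)" "B \<in> carrier_mat (n + 1) (n + 1)" "C \<in> carrier_mat (n + 1) n"
    have rho: "\<rho> x = of_real (r1 * x + r0)" for x using I by (simp add: case_I_def)
    \<comment> \<open>All powers of \<open>\<rho>\<close> are polynomials here. The diagonal data
      are the recurrence of \<open>p m\<close> scaled by \<open>r1\<close>, with \<open>r0\<close>
      added to the middle term, all times \<open>ttr_b q m\<close>.\<close>
    interpret koornwinder \<rho> s2 s1 s0 ?u p v q "\<lambda>j. [:r0, r1:] ^ j"
      "\<lambda>m j. ttr_b q m * r1 * ttr_a (p m) j" "\<lambda>m j. ttr_b q m * (r1 * ttr_b (p m) j + r0)"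
      "\<lambda>m j. ttr_b q m * r1 * ttr_c (?u m) (p m) j"
    proof (rule koornwinder.intro, rule rho2, rule S, rule u, rule p, rule q)
      fix i j x
      interpret p: orthogonal_sequence "?u i" "p i" by (rule p)
      have "x * poly (p i j) x = ttr_a (p i) j * poly (p i (j + 1)) x + ttr_b (p i) j * poly (p i j) x
          + (if j = 0 then 0 else ttr_c (?u i) (p i) j * poly (p i (j - 1)) x)"
        using arg_cong[OF p.three_term_recurrence[of j], of "\<lambda>f. poly f x"] by (simp split: if_splits)
      then have "(r1 * x + r0) * poly (p i j) x = r1 * (ttr_a (p i) j * poly (p i (j + 1)) x
          + ttr_b (p i) j * poly (p i j) x
          + (if j = 0 then 0 else ttr_c (?u i) (p i) j * poly (p i (j - 1)) x)) + r0 * poly (p i j) x"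
        by (simp only: distrib_right mult.assoc)
      then have "ttr_b q i * (r1 * x + r0) * poly (p i j) x =
          ttr_b q i * r1 * ttr_a (p i) j * poly (p i (j + 1)) x
          + ttr_b q i * (r1 * ttr_b (p i) j + r0) * poly (p i j) x
          + (if j = 0 then 0 else ttr_b q i * r1 * ttr_c (?u i) (p i) j * poly (p i (j - 1)) x)"
        by (simp add: mult.assoc) (simp add: algebra_simps)
      then show "of_real (ttr_b q i) * \<rho> x * of_real (poly (p i j) x) =
          of_real (ttr_b q i * r1 * ttr_a (p i) j * poly (p i (j + 1)) x
          + ttr_b q i * (r1 * ttr_b (p i) j + r0) * poly (p i j) x
          + (if j = 0 then 0 else ttr_b q i * r1 * ttr_c (?u i) (p i) j * poly (p i (j - 1)) x))"
        by (simp only: rho flip: of_real_mult)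
    qed (simp_all add: rho algebra_simps)
    show "second_three_term_relation \<rho> p q n A B C \<longleftrightarrow>
      A = A2_mat s2 p v q n (\<lambda>m. ttr_b q m * r1 * ttr_a (p m) (n - m)) \<and>
      B = B2_mat ?u p v q n (\<lambda>m. ttr_b q m * (r1 * ttr_b (p m) (n - m) + r0)) \<and>
      C = C2_mat s2 ?u p v q n (\<lambda>m. ttr_b q m * r1 * ttr_c (?u m) (p m) (n - m))"
      using ABC by (rule relation_iff)
  next
    fix n and A B C :: "real mat"
    assume II: "case_II \<rho> v"
      and ABC: "A \<in> carrier_mat (n + 1) (n + 2)" "B \<in> carrier_mat (n + 1) (n + 1)" "C \<in> carrier_mat (n + 1) n"
    have even: "even (m + k)" if "coeff (q m) k \<noteq> 0" for m k
      using II assms(8) that by (intro symmetric_ops_parity) (auto simp: case_II_def)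
    \<comment> \<open>\<open>m\<close> and \<open>m - 1\<close> have opposite parity, so the second
      coefficient, and with it \<open>ttr_b q m\<close>, vanishes.\<close>
    have l: "l_c q m = 0" for m
      using even[of m "m - 1"] by (cases m) (auto simp: l_c_def)
    have b: "ttr_b q m = 0" for m by (simp add: ttr_b_def l)
    \<comment> \<open>The halved exponent is right for even \<open>j\<close> only; by parity, no
      other \<open>j\<close> occurs with a nonzero coefficient.\<close>
    interpret koornwinder \<rho> s2 s1 s0 ?u p v q "\<lambda>j. ?S ^ (j div 2)" "\<lambda>m j. 0" "\<lambda>m j. 0" "\<lambda>m j. 0"
    proof (rule koornwinder.intro, rule rho2, rule S, rule u, rule p, rule q)
      fix m k x
      assume "k \<le> m" "coeff (q m) k \<noteq> 0"
      then have "even (m - k)" using even[of m k] by simp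
      then obtain i where "m - k = 2 * i" by (rule evenE)
      then show "of_real (poly (?S ^ ((m - k) div 2)) x) = \<rho> x ^ (m - k)"
        using rho2[of x] by (simp only: power_mult) (simp add: poly_power)
    qed (simp_all add: b)
    show "second_three_term_relation \<rho> p q n A B C \<longleftrightarrow>
      A = A2_mat s2 p v q n (\<lambda>m. 0) \<and> B = B2_mat ?u p v q n (\<lambda>m. 0) \<and> C = C2_mat s2 ?u p v q n (\<lambda>m. 0)"
      using ABC by (rule relation_iff)
  qed
qed

end
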